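(* Let $\varphi:\mathbb{R}^n\to\overline{\mathbb{R}}$ be a proper, lower semicontinuous and weakly convex function. Then the following assertions are equivalent: (i) $\varphi$ is convex. (ii) For all $w\in\mathbb{R}^n$ and all $(x,v)\in\operatorname{gph}\partial\varphi$, we have $d^2\varphi(x,v)(w)\ge 0$. (iii) For all $w\in\mathbb{R}^n$ and all $(x,v)\in\operatorname{gph}\partial\varphi$ such that $\varphi$ is twice epi-differentiable at $x$ for $v$, we have $d^2\varphi(x,v)(w)\ge 0$. (iv) For all $w\in\mathbb{R}^n$ and all $(x,v)\in\operatorname{gph}\partial\varphi$ such that $\varphi$ is generalized twice differentiable at $x$ for $v$, we have $d^2\varphi(x,v)(w)\ge 0$.
   Context: $\overline{\mathbb{R}}:=\mathbb{R}\cup\{\infty\}=(-\infty,\infty]$; $\mathbb{R}^n$ carries the Euclidean norm $\|\cdot\|$ and inner product $\langle\cdot,\cdot\rangle$. For $\varphi:\mathbb{R}^n\to\overline{\mathbb{R}}$, $\operatorname{dom}\varphi=\{x\mid\varphi(x)<\infty\}$ and $\operatorname{epi}\varphi=\{(x,\alpha)\in\mathbb{R}^{n+1}\mid\alpha\ge\varphi(x)\}$; $\varphi$ is proper if $\operatorname{dom}\varphi\neq\emptyset$. For $s\in\mathbb{R}$, $\varphi$ is $s$-convex if $\varphi((1-\lambda)x+\lambda y)\le(1-\lambda)\varphi(x)+\lambda\varphi(y)-\frac{s}{2}\lambda(1-\lambda)\|x-y\|^2$ for all $x,y\in\mathbb{R}^n$, $\lambda\in(0,1)$. It is convex if this holds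 with $s=0$, and weakly convex if it holds for some $s<0$. For $\Omega\subset\mathbb{R}^s$ and $\bar z\in\Omega$, the regular normal cone is $\widehat N_\Omega(\bar z)=\{v\mid\limsup_{z\to\bar z,\,z\in\Omega}\langle v,z-\bar z\rangle/\|z-\bar z\|\le 0\}$, and the limiting normal cone is $N_\Omega(\bar z)=\{v\mid\exists\,z_k\to\bar z,\ z_k\in\Omega,\ v_k\to v,\ v_k\in\widehat N_\Omega(z_k)\}$. The limiting subdifferential of $\varphi$ at $x\in\operatorname{dom}\varphi$ is $\partial\varphi(x)=\{v\mid(v,-1)\in N_{\operatorname{epi}\varphi}(x,\varphi(x))\}$ (and $\partial\varphi(x)=\emptyset$ if $x\notin\operatorname{dom}\varphi$); $\operatorname{gph}\partial\varphi=\{(x,v)\mid v\in\partial\varphi(x)\}$. For $(x,v)\in\operatorname{gph}\partial\varphi$ and $\tau>0$, put $\Delta^2_\tau\varphi(x,v)(u)=\dfrac{\varphi(x+\tau u)-\varphi(x)-\tau\langle v,u\rangle}{\frac12\tau^2}$. The second subderivative is $d^2\varphi(x,v)(w)=\liminf_{\tau\downarrow 0,\,u\to w}\Delta^2_\tau\varphi(x,v)(u)$, which may take extended-real values. $\varphi$ is twice epi-differentiable at $x$ for $v$ if for every $w\in\mathbb{R}^n$ and every sequence $\tau_k\downarrow 0$ there is a sequence $w^k\to w$ with $\Delta^2_{\tau_k}\varphi(x,v)(w^k)\to d^2\varphi(x,v)(w)$. A generalized quadratic form is a function of the form $w\mapsto\langle w,Aw\rangle+\delta_L(w)$, where $A\in\mathbb{R}^{n\times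 n}$ is symmetric, $L\subset\mathbb{R}^n$ is a linear subspace, and $\delta_L$ is $0$ on $L$ and $\infty$ elsewhere. $\varphi$ is generalized twice differentiable at $x$ for $v\in\partial\varphi(x)$ if it is twice epi-differentiable at $x$ for $v$ and $d^2\varphi(x,v)$ is a generalized quadratic form. *)

theory Defs
  imports "HOL-Analysis.Analysis"
begin

text \<open>
  Functions into the extended half-line \<open>(-\<infinity>, \<infinity>]\<close> are functions into \<^typ>\<open>ereal\<close>;
  the condition that the value \<open>-\<infinity>\<close> is never taken is a separate hypothesis where it is
  needed (it is not part of \<open>proper\<close> below).
\<close>

definition edom :: "('a \<Rightarrow> ereal) \<Rightarrow> 'a set" where
  "edom \<phi> = {x. \<phi> x < \<infinity>}"

definition epi :: "('a \<Rightarrow> ereal) \<Rightarrow> ('a \<times> real) set" where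
  "epi \<phi> = {(x, \<alpha>). \<phi> x \<le> ereal \<alpha>}"

definition proper :: "('a \<Rightarrow> ereal) \<Rightarrow> bool" where
  "proper \<phi> \<longleftrightarrow> edom \<phi> \<noteq> {}"

definition lower_semicontinuous :: "('a::topological_space \<Rightarrow> ereal) \<Rightarrow> bool" where
  "lower_semicontinuous \<phi> \<longleftrightarrow> (\<forall>x. \<phi> x \<le> Liminf (nhds x) \<phi>)"

definition s_convex :: "real \<Rightarrow> ('a::real_normed_vector \<Rightarrow> ereal) \<Rightarrow> bool" where
  "s_convex s \<phi> \<longleftrightarrow> (\<forall>x y l. 0 < l \<and> l < 1 \<longrightarrow>
     \<phi> ((1 - l) *\<^sub>R x + l *\<^sub>R y)
       \<le> ereal (1 - l) * \<phi> x + ereal l * \<phi> y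
         - ereal (s / 2 * l * (1 - l) * (norm (x - y))\<^sup>2))"

definition convex_fun :: "('a::real_normed_vector \<Rightarrow> ereal) \<Rightarrow> bool" where
  "convex_fun \<phi> \<longleftrightarrow> s_convex 0 \<phi>"

definition weakly_convex :: "('a::real_normed_vector \<Rightarrow> ereal) \<Rightarrow> bool" where
  "weakly_convex \<phi> \<longleftrightarrow> (\<exists>s<0. s_convex s \<phi>)"

text \<open>
  The upper limit is taken over \<open>z \<rightarrow> zb\<close> with \<open>z \<in> \<Omega>\<close> and \<open>z \<noteq> zb\<close>. At an isolated point
  of \<open>\<Omega>\<close> it equals \<open>-\<infinity>\<close>, and every vector is a regular normal. Both cones are only meant
  for base points in \<open>\<Omega>\<close>.
\<close>

definition regular_normal_cone :: "'a::real_inner set \<Rightarrow> 'a \<Rightarrow> 'a set" where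
  "regular_normal_cone \<Omega> zb =
     {v. Limsup (at zb within \<Omega>) (\<lambda>z. ereal (v \<bullet> (z - zb) / norm (z - zb))) \<le> 0}"

definition limiting_normal_cone :: "'a::real_inner set \<Rightarrow> 'a \<Rightarrow> 'a set" where
  "limiting_normal_cone \<Omega> zb =
     {v. \<exists>z vs. z \<longlonglongrightarrow> zb \<and> (\<forall>k::nat. z k \<in> \<Omega>) \<and> vs \<longlonglongrightarrow> v \<and>
           (\<forall>k. vs k \<in> regular_normal_cone \<Omega> (z k))}"

text \<open>
  The norm and inner product of \<open>'a \<times> real\<close> are the Euclidean ones, so this product stands
  for \<open>\<real>\<^sup>n\<^sup>+\<^sup>1\<close>.
\<close>

definition subdiff :: "('a::real_inner \<Rightarrow> ereal) \<Rightarrow> 'a \<Rightarrow> 'a set" where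
  "subdiff \<phi> x =
     {v. x \<in> edom \<phi> \<and> (v, -1) \<in> limiting_normal_cone (epi \<phi>) (x, real_of_ereal (\<phi> x))}"

definition gph_subdiff :: "('a::real_inner \<Rightarrow> ereal) \<Rightarrow> ('a \<times> 'a) set" where
  "gph_subdiff \<phi> = {(x, v). v \<in> subdiff \<phi> x}"

text \<open>The following notions are only meant for \<open>(x, v) \<in> gph_subdiff \<phi>\<close>, so that
  \<open>\<phi> x\<close> is finite and no undefined difference \<open>\<infinity> - \<infinity>\<close> occurs.\<close>

definition second_diff_quot ::
    "('a::real_inner \<Rightarrow> ereal) \<Rightarrow> 'a \<Rightarrow> 'a \<Rightarrow> real \<Rightarrow> 'a \<Rightarrow> ereal" where
  "second_diff_quot \<phi> x v t u =
     (\<phi> (x + t *\<^sub>R u) - \<phi> x - ereal (t * (v \<bullet> u))) / ereal (1 / 2 * t\<^sup>2)"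

definition second_subderiv ::
    "('a::real_inner \<Rightarrow> ereal) \<Rightarrow> 'a \<Rightarrow> 'a \<Rightarrow> 'a \<Rightarrow> ereal" where
  "second_subderiv \<phi> x v w =
     Liminf (at_right 0 \<times>\<^sub>F nhds w) (\<lambda>(t, u). second_diff_quot \<phi> x v t u)"

text \<open>As usual in variational analysis, \<open>t\<^sub>k \<down> 0\<close> means \<open>t\<^sub>k \<rightarrow> 0\<close> with all \<open>t\<^sub>k > 0\<close>; the
  sequence need not be monotone.\<close>

definition twice_epi_differentiable ::
    "('a::real_inner \<Rightarrow> ereal) \<Rightarrow> 'a \<Rightarrow> 'a \<Rightarrow> bool" where
  "twice_epi_differentiable \<phi> x v \<longleftrightarrow>
     (\<forall>w. \<forall>t::nat \<Rightarrow> real. (\<forall>k. t k > 0) \<and> t \<longlonglongrightarrow> 0 \<longrightarrow>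
        (\<exists>ws. ws \<longlonglongrightarrow> w \<and>
           (\<lambda>k. second_diff_quot \<phi> x v (t k) (ws k)) \<longlonglongrightarrow> second_subderiv \<phi> x v w))"

definition set_delta :: "'a set \<Rightarrow> 'a \<Rightarrow> ereal" where
  "set_delta L w = (if w \<in> L then 0 else \<infinity>)"

definition generalized_quadratic_form :: "(real ^ 'n \<Rightarrow> ereal) \<Rightarrow> bool" where
  "generalized_quadratic_form q \<longleftrightarrow>
     (\<exists>(A :: real ^ 'n ^ 'n) L. transpose A = A \<and> subspace L \<and>
        (\<forall>w. q w = ereal (w \<bullet> (A *v w)) + set_delta L w))"

definition generalized_twice_differentiable ::
    "(real ^ 'n \<Rightarrow> ereal) \<Rightarrow> real ^ 'n \<Rightarrow> real ^ 'n \<Rightarrow> bool" where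
  "generalized_twice_differentiable \<phi> x v \<longleftrightarrow>
     twice_epi_differentiable \<phi> x v \<and> generalized_quadratic_form (second_subderiv \<phi> x v)"

end

theory Submission
  imports Defs
begin

text \<open>
  If \<open>\<phi>\<close> is \<open>-\<rho>\<close>-convex and \<open>c > \<rho>\<close>, then \<open>\<phi> + c/2 |.|\<^sup>2\<close> is strongly convex, so its conjugate \<open>g\<close> is
  differentiable and \<open>P = \<nabla>g\<close>, where \<open>P y\<close> minimizes \<open>\<phi> + c/2 |.|\<^sup>2 - \<langle>y, .\<rangle>\<close>, is Lipschitz. By Rademacher's
  theorem \<open>P\<close> has a derivative \<open>M\<close> at almost every \<open>y\<close>. There the Fenchel inequality turns the
  second-order expansion of \<open>g\<close> into the one of \<open>\<phi>\<close>: \<open>M\<close> is symmetric and \<open>\<phi>\<close> is generalized twice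
  differentiable at \<open>P y\<close> for \<open>y - c P y\<close>, with second subderivative \<open>\<langle>M u, u\<rangle> - c |M u|\<^sup>2\<close> at \<open>M u\<close> and
  \<open>\<infinity>\<close> off the range of \<open>M\<close>. If this is nonnegative, then \<open>\<langle>M u, u\<rangle> \<le> |u|\<^sup>2/c\<close> almost everywhere; integrating
  along lines yields \<open>g (y + u) \<le> g y + \<langle>P y, u\<rangle> + |u|\<^sup>2/(2c)\<close>, which dualizes to an affine minorant of
  \<open>\<phi>\<close> that is exact at \<open>P y\<close>. Letting \<open>c \<rightarrow> \<infinity>\<close>, so that \<open>P (c x) \<rightarrow> x\<close>, gives convexity.
\<close>

section \<open>Rademacher's theorem\<close>

text \<open>
  Adding a linear term makes \<open>F\<close> a bi-Lipschitz homeomorphism \<open>G\<close> of the line. The measure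
  \<open>A \<mapsto> |G(A)|\<close> is absolutely continuous, because Lipschitz maps preserve null sets, and its
  Radon-Nikodym density is the derivative of \<open>G\<close>.
\<close>

lemma lipschitz_has_integral_derivative:
  fixes F :: "real \<Rightarrow> real"
  assumes lip: "\<And>s t. \<bar>F s - F t\<bar> \<le> L * \<bar>s - t\<bar>"
  obtains h where "\<And>a b. a \<le> b \<Longrightarrow> (h has_integral (F b - F a)) {a..b}"
proof -
  define K where "K = \<bar>L\<bar> + 1"
  have K: "K > 0" "L \<le> K" by (auto simp: K_def)
  have lipK: "\<bar>F s - F t\<bar> \<le> K * \<bar>s - t\<bar>" for s t
    using lip[of s t] mult_right_mono[OF K(2), of "\<bar>s - t\<bar>"] by simp
  \<comment> \<open>\<open>F\<close> has slopes between \<open>- K\<close> and \<open>K\<close>, so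
    those of \<open>G\<close> lie between \<open>K\<close> and \<open>3 * K\<close>. The lower bound
    makes the inverse of \<open>G\<close> Lipschitz, the upper one makes \<open>G\<close> preserve
    null sets.\<close>
  define G where "G = (\<lambda>t. F t + 2 * K * t)"
  have Glow: "K * (t - s) \<le> G t - G s" if "s \<le> t" for s t
    using lipK[of t s] that by (simp add: G_def algebra_simps abs_if split: if_splits)
  have Gup: "\<bar>G t - G s\<bar> \<le> 3 * K * \<bar>t - s\<bar>" for s t
    using lipK[of t s] K by (simp add: G_def abs_if algebra_simps split: if_splits)
  have Glow': "K * \<bar>t - s\<bar> \<le> \<bar>G t - G s\<bar>" for s t
    using Glow[of s t] Glow[of t s] K by (cases "s \<le> t") (auto simp: abs_if)
  have smono: "strict_mono G"
  proof (rule strict_monoI)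
    fix s t :: real assume "s < t"
    then have "0 < K * (t - s)" using K by simp
    with Glow[of s t] \<open>s < t\<close> show "G s < G t" by linarith
  qed
  have contG: "continuous_on S G" for S
  proof (rule lipschitz_on_continuous_on[of "3 * K"])
    show "(3 * K)-lipschitz_on S G"
      using Gup K by (auto intro!: lipschitz_onI simp: dist_real_def)
  qed
  have surj: "\<exists>t. G t = y" for y
  proof -
    define r where "r = \<bar>y - G 0\<bar> / K"
    have r: "r \<ge> 0" "K * r = \<bar>y - G 0\<bar>" using K by (auto simp: r_def)
    have "G (-r) \<le> y" "y \<le> G r"
      using Glow[of 0 r] Glow[of "-r" 0] r by (auto simp: abs_if split: if_splits)
    then show ?thesis
      using IVT'[of G "-r" y r] r contG by auto
  qed
  define H where "H = the_inv G"
  have inj: "inj G" using smono by (rule strict_mono_imp_inj_on)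
  have HG [simp]: "H (G t) = t" for t
    unfolding H_def using inj by (rule the_inv_f_f)
  have GH [simp]: "G (H y) = y" for y
    using surj[of y] by auto
  have contH: "continuous_on UNIV H"
  proof (rule lipschitz_on_continuous_on[of "1 / K"])
    show "(1 / K)-lipschitz_on UNIV H"
      using Glow'[of "H x" "H y" for x y] K
      by (auto intro!: lipschitz_onI simp: dist_real_def field_simps)
  qed
  have Hmeas [measurable]: "H \<in> borel_measurable borel"
    using contH by (rule borel_measurable_continuous_onI)
  \<comment> \<open>\<open>H\<close> is the inverse of \<open>G\<close>, so this pushforward assigns
    to \<open>A\<close> the Lebesgue measure of its image under \<open>G\<close>.\<close>
  define N where "N = distr lborel borel H"
  have vim: "H -` A = G ` A" for A
    by (auto simp: image_iff) (metis GH)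
  have ac: "absolutely_continuous lborel N"
    unfolding absolutely_continuous_def
  proof
    fix A :: "real set" assume "A \<in> null_sets lborel"
    then have A: "A \<in> sets borel" and "negligible A"
      by (auto simp: negligible_iff_null_sets null_sets_completionI)
    then have "negligible (G ` A)"
    proof (intro negligible_locally_Lipschitz_image)
      fix x assume "x \<in> A"
      show "\<exists>T B. open T \<and> x \<in> T \<and> (\<forall>y\<in>A \<inter> T. norm (G y - G x) \<le> B * norm (y - x))"
        using Gup by (intro exI[of _ UNIV] exI[of _ "3 * K"]) (auto)
    qed auto
    moreover have "G ` A \<in> sets borel"
      using measurable_sets[OF Hmeas A] by (simp add: vim)
    ultimately have "emeasure lborel (G ` A) = 0"
      by (simp add: negligible_iff_emeasure0)
    then show "A \<in> null_sets N"
      using A by (auto simp: N_def emeasure_distr vim null_sets_def)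
  qed
  obtain h where h [measurable]: "h \<in> borel_measurable lborel" and dens: "density lborel h = N"
    using sigma_finite_measure.Radon_Nikodym[OF sigma_finite_lborel ac] by (auto simp: N_def)
  have hint: "(\<integral>\<^sup>+x. h x * indicator {a..b} x \<partial>lborel) = ennreal (G b - G a)" if "a \<le> b" for a b
  proof -
    have "G ` {a..b} = {G a..G b}"
    proof (intro equalityI subsetI)
      fix y assume "y \<in> {G a..G b}"
      then have "H y \<in> {a..b}"
        by (metis GH atLeastAtMost_iff smono strict_mono_less_eq)
      then show "y \<in> G ` {a..b}" by (metis GH imageI)
    qed (auto simp: strict_mono_less_eq[OF smono])
    moreover have "emeasure N {a..b} = emeasure lborel (G ` {a..b})"
      by (simp add: N_def emeasure_distr vim)
    moreover have "G a \<le> G b" using that by (simp add: strict_mono_less_eq[OF smono])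
    ultimately have "emeasure N {a..b} = ennreal (G b - G a)" by simp
    then show ?thesis
      by (simp add: dens[symmetric] emeasure_density)
  qed
  \<comment> \<open>The density takes values in \<open>ennreal\<close>. Its finite integrals over
    bounded intervals exclude the value \<infinity> up to a null set, so that the real function
    \<open>k\<close> can replace it.\<close>
  have fin: "AE x in lborel. h x < \<infinity>"
  proof -
    have "AE x in lborel. x \<in> {- real n..real n} \<longrightarrow> h x < \<infinity>" for n
    proof -
      have "AE x in lborel. h x * indicator {- real n..real n} x \<noteq> \<infinity>"
        using hint[of "- real n" "real n"] by (intro nn_integral_PInf_AE) auto
      then show ?thesis by eventually_elim (auto simp: less_top[symmetric])
    qed
    then have "AE x in lborel. \<forall>n::nat. x \<in> {- real n..real n} \<longrightarrow> h x < \<infinity>"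
      unfolding AE_all_countable by blast
    then show ?thesis
    proof eventually_elim
      case (elim x)
      obtain n where "\<bar>x\<bar> \<le> real n" using real_arch_simple by blast
      with elim show ?case by (auto simp: abs_le_iff)
    qed
  qed
  define k where "k = (\<lambda>x. enn2real (h x))"
  have [measurable]: "k \<in> borel_measurable borel"
    using h unfolding k_def by simp
  have "(k has_integral (G b - G a)) {a..b}" if "a \<le> b" for a b
  proof -
    have "((\<lambda>x. k x * indicator {a..b} x) has_integral (G b - G a)) UNIV"
    proof (rule nn_integral_has_integral)
      have "(\<integral>\<^sup>+x. ennreal (k x * indicator {a..b} x) \<partial>lborel)
          = (\<integral>\<^sup>+x. h x * indicator {a..b} x \<partial>lborel)"
        using fin by (intro nn_integral_cong_AE) (auto simp: k_def indicator_def elim!: eventually_mono)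
      also have "\<dots> = ennreal (G b - G a)" using that by (rule hint)
      finally show "(\<integral>\<^sup>+x. ennreal (k x * indicator {a..b} x) \<partial>lborel) = ennreal (G b - G a)" .
      show "0 \<le> G b - G a" using that by (simp add: strict_mono_less_eq[OF smono])
    qed (auto simp: k_def)
    then show ?thesis
      by (subst has_integral_restrict_UNIV[symmetric])
        (simp add: indicator_def of_bool_def if_distrib[of "\<lambda>z. _ * z"] cong: if_cong)
  qed
  then have "((\<lambda>x. k x - 2 * K) has_integral (G b - G a - 2 * K * (b - a))) {a..b}" if "a \<le> b" for a b
    using that has_integral_const_real[of "2 * K" a b]
    by (intro has_integral_diff) (auto simp: mult.commute)
  then show ?thesis
    by (intro that[of "\<lambda>x. k x - 2 * K"]) (simp add: G_def algebra_simps)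
qed

text \<open>By Lebesgue's differentiation theorem the averages of \<open>h\<close> over the
  intervals from \<open>t\<close> to \<open>t + s\<close> converge to \<open>h t\<close> for almost
  every \<open>t\<close>, and these averages are the difference quotients of \<open>F\<close>. The
  intervals extend to the right of \<open>t\<close> only, hence the one-sided limit.\<close>

lemma lipschitz_AE_right_derivative:
  fixes F :: "real \<Rightarrow> real"
  assumes lip: "\<And>s t. \<bar>F s - F t\<bar> \<le> L * \<bar>s - t\<bar>"
  obtains h where "\<And>a b. a \<le> b \<Longrightarrow> (h has_integral (F b - F a)) {a..b}"
    "AE t in lborel. ((\<lambda>s. (F (t + s) - F t) / s) \<longlongrightarrow> h t) (at_right 0)"
proof -
  obtain h where h: "\<And>a b. a \<le> b \<Longrightarrow> (h has_integral (F b - F a)) {a..b}"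
    using lipschitz_has_integral_derivative[OF lip] by blast
  have "h integrable_on cbox a b" for a b
    using h[of a b] by (cases "a \<le> b") (auto simp: integrable_on_def)
  then obtain N where N: "negligible N"
    "\<And>x e. \<lbrakk>x \<notin> N; 0 < e\<rbrakk> \<Longrightarrow>
       \<exists>d>0. \<forall>s. 0 < s \<and> s < d \<longrightarrow>
         norm (integral (cbox x (x + s *\<^sub>R One)) h /\<^sub>R s ^ DIM(real) - h x) < e"
    using integrable_ccontinuous_explicit[of h] by blast
  have "((\<lambda>s. (F (t + s) - F t) / s) \<longlongrightarrow> h t) (at_right 0)" if tN: "t \<notin> N" for t
  proof (rule tendstoI)
    fix e :: real assume "0 < e"
    then obtain d where d: "d > 0" and *: "\<And>s. 0 < s \<Longrightarrow> s < d \<Longrightarrow>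
         norm (integral (cbox t (t + s *\<^sub>R One)) h /\<^sub>R s ^ DIM(real) - h t) < e"
      using N(2)[OF tN \<open>0 < e\<close>] by blast
    have "dist ((F (t + s) - F t) / s) (h t) < e" if s: "0 < s" "s < d" for s
    proof -
      have "integral {t..t + s} h = F (t + s) - F t"
        using h[of t "t + s"] s by (intro integral_unique) auto
      with *[OF s] show ?thesis by (simp add: dist_real_def divide_inverse mult.commute)
    qed
    then show "\<forall>\<^sub>F s in at_right 0. dist ((F (t + s) - F t) / s) (h t) < e"
      using d by (auto simp: eventually_at_right_field)
  qed
  moreover have "AE t in lborel. t \<notin> N"
    using N(1) by (metis AE_not_in negligible_iff_null_sets AE_completion_iff)
  ultimately show ?thesis using h that by (blast intro: AE_mp AE_I2 eventually_mono)
qed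

text \<open>
  One-sided derivatives suffice: additivity in the direction makes them two-sided almost everywhere.
\<close>

definition has_dirderiv :: "('a::real_normed_vector \<Rightarrow> real) \<Rightarrow> 'a \<Rightarrow> real \<Rightarrow> 'a \<Rightarrow> bool" where
  "has_dirderiv f w l x \<longleftrightarrow> ((\<lambda>s. (f (x + s *\<^sub>R w) - f x) / s) \<longlongrightarrow> l) (at_right 0)"

lemma has_dirderiv_unique: "has_dirderiv f w l x \<Longrightarrow> has_dirderiv f w m x \<Longrightarrow> l = m"
  unfolding has_dirderiv_def by (rule tendsto_unique[rotated]) auto

lemma inverse_Suc_at_right_0:
  "filterlim (\<lambda>n. inverse (real (Suc n))) (at_right 0) sequentially"
  by (rule tendsto_imp_filterlim_at_right[OF LIMSEQ_inverse_real_of_nat]) simp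

lemma has_dirderiv_LIMSEQ:
  assumes "has_dirderiv f w l x"
  shows "(\<lambda>n. real (Suc n) * (f (x + inverse (real (Suc n)) *\<^sub>R w) - f x)) \<longlonglongrightarrow> l"
proof -
  have "((\<lambda>s. (f (x + s *\<^sub>R w) - f x) / s) \<longlongrightarrow> l) (at_right 0)"
    using assms by (simp add: has_dirderiv_def)
  from filterlim_compose[OF this inverse_Suc_at_right_0] show ?thesis
    by (simp add: divide_inverse mult.commute)
qed

lemma has_dirderiv_scale:
  assumes "has_dirderiv f w l x" "r \<ge> 0"
  shows "has_dirderiv f (r *\<^sub>R w) (r * l) x"
proof (cases "r = 0")
  case False
  with assms have r: "r > 0" by simp
  have "filterlim (\<lambda>s. s * r) (at_right 0) (at_right 0)"
    using r by (auto simp: filterlim_at eventually_at_right_field intro!: tendsto_eq_intros exI[of _ 1])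
  from filterlim_compose[OF assms(1)[unfolded has_dirderiv_def] this]
  have "((\<lambda>s. r * ((f (x + (s * r) *\<^sub>R w) - f x) / (s * r))) \<longlongrightarrow> r * l) (at_right 0)"
    by (intro tendsto_intros)
  then show ?thesis using r by (simp add: has_dirderiv_def)
qed (simp add: has_dirderiv_def)

text \<open>
  For a continuous function each instance of this Cauchy condition is closed in \<open>x\<close>, which gives
  Borel measurability of the set where the derivative exists.
\<close>

lemma has_dirderiv_existence_iff:
  fixes f :: "'a::real_normed_vector \<Rightarrow> real"
  defines "q \<equiv> \<lambda>x w s. (f (x + s *\<^sub>R w) - f x) / s"
  shows "(\<exists>l. has_dirderiv f w l x) \<longleftrightarrow>
    (\<forall>n. \<exists>m. \<forall>s s'. 0 < s \<and> s < inverse (real (Suc m)) \<and> 0 < s' \<and> s' < inverse (real (Suc m))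
       \<longrightarrow> \<bar>q x w s - q x w s'\<bar> \<le> inverse (real (Suc n)))" (is "_ \<longleftrightarrow> (\<forall>n. \<exists>m. ?C n m)")
proof
  assume "\<exists>l. has_dirderiv f w l x"
  then obtain l where l: "(q x w \<longlongrightarrow> l) (at_right 0)" by (auto simp: has_dirderiv_def q_def)
  show "\<forall>n. \<exists>m. ?C n m"
  proof
    fix n
    have "\<forall>\<^sub>F s in at_right 0. dist (q x w s) l < inverse (real (Suc n)) / 2"
      by (rule tendstoD[OF l]) simp
    then obtain d where d: "d > 0" "\<And>s. 0 < s \<Longrightarrow> s < d \<Longrightarrow> dist (q x w s) l < inverse (real (Suc n)) / 2"
      by (auto simp: eventually_at_right_field)
    obtain m where m: "inverse (real (Suc m)) < d" using reals_Archimedean[OF d(1)] by blast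
    show "\<exists>m. ?C n m"
    proof (intro exI[of _ m] allI impI)
      fix s s' assume "0 < s \<and> s < inverse (real (Suc m)) \<and> 0 < s' \<and> s' < inverse (real (Suc m))"
      then have "0 < s" "s < d" "0 < s'" "s' < d"
        using m by (auto simp del: of_nat_Suc)
      then have "dist (q x w s) l < inverse (real (Suc n)) / 2" "dist (q x w s') l < inverse (real (Suc n)) / 2"
        by (simp_all only: d(2))
      then show "\<bar>q x w s - q x w s'\<bar> \<le> inverse (real (Suc n))"
        unfolding dist_real_def by linarith
    qed
  qed
next
  assume C: "\<forall>n. \<exists>m. ?C n m"
  \<comment> \<open>The quotients along one sequence of step sizes supply a candidate for the limit;
    the condition \<open>?C\<close> then compares every small step with this sequence.\<close>
  define X where "X = (\<lambda>k. q x w (inverse (real (Suc k))))"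
  have inv: "inverse (real (Suc k)) < inverse (real (Suc m))" if "k > m" for k m
    using that by (simp add: field_simps)
  have "Cauchy X"
    unfolding metric_Cauchy_iff2
  proof
    fix j
    \<comment> \<open>The tolerance belonging to \<open>Suc j\<close> is smaller than the one for
      \<open>j\<close>, which turns the weak inequality in \<open>?C\<close> into the strict one of
      a Cauchy sequence.\<close>
    obtain m where m: "?C (Suc j) m" using C by blast
    have lt: "inverse (real (Suc (Suc j))) < inverse (real (Suc j))" by (rule inv) simp
    have "dist (X a) (X b) < inverse (real (Suc j))" if ab: "a > m" "b > m" for a b
    proof -
      have "\<bar>X a - X b\<bar> \<le> inverse (real (Suc (Suc j)))"
        unfolding X_def using m inv[OF ab(1)] inv[OF ab(2)] by (auto simp del: of_nat_Suc)
      with lt show ?thesis unfolding dist_real_def by (rule le_less_trans[rotated])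
    qed
    then show "\<exists>M. \<forall>m\<ge>M. \<forall>n\<ge>M. dist (X m) (X n) < inverse (real (Suc j))"
      by (intro exI[of _ "Suc m"]) auto
  qed
  then obtain l where l: "X \<longlonglongrightarrow> l" using real_Cauchy_convergent convergent_def by blast
  have "(q x w \<longlongrightarrow> l) (at_right 0)"
  proof (rule tendstoI)
    fix e :: real assume "e > 0"
    then obtain n where n: "inverse (real (Suc n)) < e" using reals_Archimedean by blast
    obtain m where m: "?C n m" using C by blast
    have "\<bar>q x w s - l\<bar> \<le> inverse (real (Suc n))" if s: "0 < s" "s < inverse (real (Suc m))" for s
    proof (rule tendsto_upperbound)
      show "(\<lambda>k. \<bar>q x w s - X k\<bar>) \<longlonglongrightarrow> \<bar>q x w s - l\<bar>" by (intro tendsto_intros l)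
      show "\<forall>\<^sub>F k in sequentially. \<bar>q x w s - X k\<bar> \<le> inverse (real (Suc n))"
        using eventually_gt_at_top[of m]
      proof eventually_elim
        case (elim k)
        from m s inv[OF this] show ?case unfolding X_def by (auto simp del: of_nat_Suc)
      qed
    qed auto
    then show "\<forall>\<^sub>F s in at_right 0. dist (q x w s) l < e"
      unfolding eventually_at_right_field dist_real_def using n
      by (intro exI[of _ "inverse (real (Suc m))"]) (auto intro: le_less_trans simp del: of_nat_Suc)
  qed
  then show "\<exists>l. has_dirderiv f w l x" by (auto simp: has_dirderiv_def q_def)
qed

lemma has_dirderiv_measurable:
  fixes f :: "'a::euclidean_space \<Rightarrow> real"
  assumes "continuous_on UNIV f"
  shows "{x. \<exists>l. has_dirderiv f w l x} \<in> sets borel"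
proof -
  define D where "D = (\<lambda>r e. {x. \<forall>s s'. 0 < s \<and> s < r \<and> 0 < s' \<and> s' < r \<longrightarrow>
      \<bar>(f (x + s *\<^sub>R w) - f x) / s - (f (x + s' *\<^sub>R w) - f x) / s'\<bar> \<le> e})"
  have "closed (D r e)" for r e
    unfolding D_def
  proof (intro closed_Collect_all closed_Collect_imp closed_Collect_le open_Collect_const)
    fix s s' :: real
    have "continuous_on UNIV (\<lambda>x. f (x + s *\<^sub>R w))" for s :: real
      by (rule continuous_on_compose2[OF assms]) (auto intro!: continuous_intros)
    then show "continuous_on UNIV (\<lambda>x. \<bar>(f (x + s *\<^sub>R w) - f x) / s - (f (x + s' *\<^sub>R w) - f x) / s'\<bar>)"
      using assms by (auto intro!: continuous_intros simp: divide_inverse)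
  qed auto
  then have "(\<Inter>n. \<Union>m. D (inverse (real (Suc m))) (inverse (real (Suc n)))) \<in> sets borel"
    by (intro sets.countable_INT'' sets.countable_UN' countableI_type borel_closed) auto
  also have "(\<Inter>n. \<Union>m. D (inverse (real (Suc m))) (inverse (real (Suc n)))) = {x. \<exists>l. has_dirderiv f w l x}"
    unfolding has_dirderiv_existence_iff D_def by blast
  finally show ?thesis .
qed

section \<open>Almost every point and almost every line in a given direction\<close>

lemma lborel_AE_translate:
  fixes c :: "'a::euclidean_space"
  assumes "{x. P x} \<in> sets borel"
  shows "(AE x in lborel. P (x + c)) \<longleftrightarrow> (AE x in lborel. P x)"
proof -
  have "(AE x in lborel. P x) \<longleftrightarrow> (AE x in distr lborel borel ((+) c). P x)"
    by (subst lborel_distr_plus) (rule refl)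
  also have "\<dots> \<longleftrightarrow> (AE x in lborel. P (c + x))"
    by (rule AE_distr_iff) (use assms in simp_all)
  finally show ?thesis by (simp add: add.commute)
qed

text \<open>Fubini's theorem exchanges the quantifiers over \<open>x\<close> and \<open>t\<close>.
  For fixed \<open>t\<close> the shift by \<open>t *\<^sub>R w\<close> preserves Lebesgue measure,
  so the inner statement is then independent of \<open>t\<close>.\<close>

lemma lborel_AE_lines:
  fixes w :: "'a::euclidean_space"
  assumes "{x. P x} \<in> sets borel"
  shows "(AE x in lborel. AE t in lborel. P (x + t *\<^sub>R w)) \<longleftrightarrow> (AE x in lborel. P x)"
proof -
  have "(\<lambda>z::'a \<times> real. fst z + snd z *\<^sub>R w) \<in> measurable borel borel"
    by (intro borel_measurable_continuous_onI continuous_intros)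
  from measurable_sets[OF this assms]
  have "{z. P (fst z + snd z *\<^sub>R w)} \<in> sets (borel :: ('a \<times> real) measure)"
    by (simp add: vimage_def)
  then have "{z \<in> space (lborel \<Otimes>\<^sub>M lborel). P (fst z + snd z *\<^sub>R w)} \<in> sets (lborel \<Otimes>\<^sub>M lborel)"
    unfolding lborel_prod by simp
  then have "(AE x in lborel. AE t in lborel. P (x + t *\<^sub>R w)) \<longleftrightarrow>
      (AE t in lborel. AE x in lborel. P (x + t *\<^sub>R w))"
    by (rule lborel_pair.AE_commute)
  also have "\<dots> \<longleftrightarrow> (AE t in (lborel::real measure). AE x in lborel. P x)"
    by (simp only: lborel_AE_translate[OF assms])
  also have "\<dots> \<longleftrightarrow> (AE x in lborel. P x)"
  proof -
    \<comment> \<open>The real line is not a null set: a statement without \<open>t\<close> that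
      holds for almost every \<open>t\<close> holds outright.\<close>
    have "\<not> (AE t in (lborel :: real measure). False)"
      using mem_closed_if_AE_lebesgue[of "{} :: real set"] AE_completion by fastforce
    then show ?thesis by (cases "AE x in lborel. P x") auto
  qed
  finally show ?thesis .
qed

text \<open>On each line in direction \<open>w\<close> the function is Lipschitz in one real
  variable, where the derivative is known to exist almost everywhere. Measurability of the set of
  good points allows the passage from lines to space.\<close>

lemma lipschitz_AE_dirderiv:
  fixes f :: "'a::euclidean_space \<Rightarrow> real"
  assumes lip: "L-lipschitz_on UNIV f"
  shows "AE x in lborel. \<exists>l. has_dirderiv f w l x"
proof -
  have "AE t in lborel. \<exists>l. has_dirderiv f w l (x + t *\<^sub>R w)" for x
  proof -
    have "\<bar>f (x + s *\<^sub>R w) - f (x + t *\<^sub>R w)\<bar> \<le> (L * norm w) * \<bar>s - t\<bar>" for s t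
      using lipschitz_onD[OF lip, of "x + s *\<^sub>R w" "x + t *\<^sub>R w"]
      by (simp add: dist_norm mult_ac flip: scaleR_diff_left)
    then obtain h where "AE t in lborel.
        ((\<lambda>s. (f (x + (t + s) *\<^sub>R w) - f (x + t *\<^sub>R w)) / s) \<longlongrightarrow> h t) (at_right 0)"
      using lipschitz_AE_right_derivative[of "\<lambda>t. f (x + t *\<^sub>R w)" "L * norm w"] by blast
    then show ?thesis
      by eventually_elim (auto simp: has_dirderiv_def scaleR_add_left add.assoc)
  qed
  then have "AE x in lborel. AE t in lborel. \<exists>l. has_dirderiv f w l (x + t *\<^sub>R w)" by simp
  then show ?thesis
    using lipschitz_on_continuous_on[OF lip]
    by (subst (asm) lborel_AE_lines) (rule has_dirderiv_measurable)
qed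

text \<open>A mean value inequality from an almost everywhere bound: on almost every line the
  increment is the integral of the derivative, and continuity of \<open>f\<close> extends the
  estimate to every \<open>x\<close>.\<close>

lemma lipschitz_increment_le:
  fixes f :: "'a::euclidean_space \<Rightarrow> real"
  assumes lip: "L-lipschitz_on UNIV f"
    and le: "AE x in lborel. \<forall>l. has_dirderiv f w l x \<longrightarrow> l \<le> C"
  shows "f (x + w) - f x \<le> C"
proof -
  have cont: "continuous_on UNIV f" by (rule lipschitz_on_continuous_on[OF lip])
  \<comment> \<open>The exceptional set is enclosed in a Borel null set, because
    \<open>lborel_AE_lines\<close> asks for measurability.\<close>
  obtain N where N: "{x. \<not> (\<forall>l. has_dirderiv f w l x \<longrightarrow> l \<le> C)} \<subseteq> N"
      "emeasure lborel N = 0" "N \<in> sets lborel"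
    using AE_E[OF le] by auto
  have "AE x in lborel. x \<notin> N" using N by (intro AE_not_in) (auto simp: null_sets_def)
  then have "AE x in lborel. AE t in lborel. x + t *\<^sub>R w \<notin> N"
    using N(3) by (subst lborel_AE_lines) (auto simp: Collect_neg_eq)
  then have "AE x in lborel. f (x + w) - f x \<le> C"
  proof eventually_elim
    case (elim x)
    have "\<bar>f (x + s *\<^sub>R w) - f (x + t *\<^sub>R w)\<bar> \<le> (L * norm w) * \<bar>s - t\<bar>" for s t
      using lipschitz_onD[OF lip, of "x + s *\<^sub>R w" "x + t *\<^sub>R w"]
      by (simp add: dist_norm mult_ac flip: scaleR_diff_left)
    then obtain h where h: "\<And>a b. a \<le> b \<Longrightarrow> (h has_integral (f (x + b *\<^sub>R w) - f (x + a *\<^sub>R w))) {a..b}"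
      and lim: "AE t in lborel.
        ((\<lambda>s. (f (x + (t + s) *\<^sub>R w) - f (x + t *\<^sub>R w)) / s) \<longlongrightarrow> h t) (at_right 0)"
      using lipschitz_AE_right_derivative[of "\<lambda>t. f (x + t *\<^sub>R w)" "L * norm w"] by blast
    from lim elim have "AE t in lborel. h t \<le> C"
    proof eventually_elim
      case (elim t)
      then have "has_dirderiv f w (h t) (x + t *\<^sub>R w)"
        by (simp add: has_dirderiv_def scaleR_add_left add.assoc)
      with elim N(1) show ?case by auto
    qed
    then have "AE t in lebesgue. h t \<le> C" by (rule AE_completion)
    then obtain Z where Z: "negligible Z" "{t. \<not> h t \<le> C} \<subseteq> Z"
      unfolding eventually_ae_filter_negligible by blast
    \<comment> \<open>Capping \<open>h\<close> at \<open>C\<close> alters it on a null set only and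
      makes the bound hold pointwise, as the comparison of integrals demands.\<close>
    have "((\<lambda>t. min (h t) C) has_integral (f (x + w) - f x)) {0..1}"
    proof (rule has_integral_spike[OF Z(1)])
      show "(h has_integral (f (x + w) - f x)) {0..1}" using h[of 0 1] by simp
      show "min (h t) C = h t" if "t \<in> {0..1} - Z" for t
        using that Z(2) by (auto simp: min_def)
    qed
    from has_integral_le[OF this has_integral_const_real[of C 0 1]] show ?case by simp
  qed
  then have "AE x in lebesgue. x \<in> {x. f (x + w) - f x \<le> C}" by (simp add: AE_completion)
  moreover have "closed {x. f (x + w) - f x \<le> C}"
    by (intro closed_Collect_le continuous_intros cont continuous_on_compose2[OF cont]) auto
  ultimately show ?thesis using mem_closed_if_AE_lebesgue by blast
qed

section \<open>Linearity of the directional derivative almost everywhere\<close>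

text \<open>At almost every \<open>x\<close> the value \<open>f x\<close> is the limit of averages
  over shrinking cubes with corner \<open>x\<close>, and all of these averages vanish.\<close>

lemma AE_zero_if_cbox_integrals_zero:
  fixes f :: "'a::euclidean_space \<Rightarrow> real"
  assumes "\<And>a b. (f has_integral 0) (cbox a b)"
  shows "AE x in lborel. f x = 0"
proof -
  have int: "\<And>a b. f integrable_on cbox a b" using assms by (auto simp: integrable_on_def)
  obtain N where N: "negligible N"
    "\<And>x e. \<lbrakk>x \<notin> N; 0 < e\<rbrakk> \<Longrightarrow>
       \<exists>d>0. \<forall>s. 0 < s \<and> s < d \<longrightarrow>
         norm (integral (cbox x (x + s *\<^sub>R One)) f /\<^sub>R s ^ DIM('a) - f x) < e"
    using integrable_ccontinuous_explicit[OF int] by metis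
  have "f x = 0" if "x \<notin> N" for x
  proof (rule ccontr)
    assume "f x \<noteq> 0"
    then obtain d where d: "d > 0" "\<forall>s. 0 < s \<and> s < d \<longrightarrow>
         norm (integral (cbox x (x + s *\<^sub>R One)) f /\<^sub>R s ^ DIM('a) - f x) < \<bar>f x\<bar>"
      using N(2)[OF \<open>x \<notin> N\<close>, of "\<bar>f x\<bar>"] by auto
    have "integral (cbox x (x + (d/2) *\<^sub>R One)) f = 0" by (rule integral_unique[OF assms])
    with d(2)[rule_format, of "d/2"] d(1) show False by simp
  qed
  moreover have "AE x in lborel. x \<notin> N"
    using N(1) by (metis AE_not_in negligible_iff_null_sets AE_completion_iff)
  ultimately show ?thesis by (auto elim: eventually_mono)
qed

text \<open>Continuity of translation in the \<open>L1\<close> norm, by dominated convergence. The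
  boundary of the box is a null set, and off it the shifted indicator eventually equals the original
  one.\<close>

lemma L1_translate_indicator_cbox:
  fixes a b u :: "'a::euclidean_space"
  assumes r: "r \<longlonglongrightarrow> 0" "\<And>n. \<bar>r n\<bar> \<le> 1"
  shows "(\<lambda>n. \<integral>x. \<bar>indicat_real (cbox a b) (x - r n *\<^sub>R u) - indicator (cbox a b) x\<bar> \<partial>lborel) \<longlonglongrightarrow> (0::real)"
proof -
  obtain R where R: "\<And>x. x \<in> cbox a b \<Longrightarrow> norm x \<le> R"
    using bounded_cbox[of a b] by (auto simp: bounded_iff)
  \<comment> \<open>Because \<open>r n\<close> is at most 1 in absolute value, this ball contains
    the box and all its shifts, so its indicator dominates.\<close>
  define B where "B = cball (0::'a) (R + norm u)"
  have "(\<lambda>n. \<integral>x. \<bar>indicat_real (cbox a b) (x - r n *\<^sub>R u) - indicator (cbox a b) x\<bar> \<partial>lborel)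
     \<longlonglongrightarrow> (\<integral>x. 0 \<partial>(lborel :: 'a measure))"
  proof (rule integral_dominated_convergence[where w = "indicator B"])
    show "integrable lborel (indicat_real B)"
      unfolding B_def using emeasure_lborel_cball_finite by (intro integrable_real_indicator) auto
    show "AE x in lborel. norm \<bar>indicat_real (cbox a b) (x - r n *\<^sub>R u) - indicator (cbox a b) x\<bar> \<le> indicator B x" for n
    proof (rule AE_I2)
      fix x :: 'a
      have "x \<in> B" if "x \<in> cbox a b"
        using R[OF that] by (simp add: B_def add_increasing2)
      moreover have "x \<in> B" if "x - r n *\<^sub>R u \<in> cbox a b"
      proof -
        have "norm x \<le> norm (x - r n *\<^sub>R u) + norm (r n *\<^sub>R u)"
          using norm_triangle_ineq[of "x - r n *\<^sub>R u" "r n *\<^sub>R u"] by simp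
        also have "norm (r n *\<^sub>R u) \<le> norm u"
          using r(2)[of n] mult_right_mono[of "\<bar>r n\<bar>" 1 "norm u"] by simp
        finally show ?thesis using R[OF that] by (simp add: B_def)
      qed
      ultimately show "norm \<bar>indicat_real (cbox a b) (x - r n *\<^sub>R u) - indicator (cbox a b) x\<bar> \<le> indicator B x"
        by (auto simp: indicator_def)
    qed
    have "AE x in lborel. x \<notin> cbox a b - box a b"
      using negligible_frontier_interval[of a b]
      by (metis AE_not_in negligible_iff_null_sets AE_completion_iff)
    then show "AE x in lborel. (\<lambda>n. \<bar>indicat_real (cbox a b) (x - r n *\<^sub>R u) - indicator (cbox a b) x\<bar>) \<longlonglongrightarrow> 0"
    proof eventually_elim
      case (elim x)
      have lim: "(\<lambda>n. x - r n *\<^sub>R u) \<longlonglongrightarrow> x"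
        using r(1) by (auto intro!: tendsto_eq_intros)
      have "\<forall>\<^sub>F n in sequentially. indicat_real (cbox a b) (x - r n *\<^sub>R u) = indicator (cbox a b) x"
      proof (cases "x \<in> cbox a b")
        case True
        with elim have "x \<in> box a b" by auto
        from topological_tendstoD[OF lim open_box this] show ?thesis
          by eventually_elim (use True box_subset_cbox[of a b] in \<open>auto simp: indicator_def\<close>)
      next
        case False
        from topological_tendstoD[OF lim open_Compl[OF closed_cbox] this[folded Compl_iff]] show ?thesis
          by eventually_elim (use False in \<open>auto simp: indicator_def\<close>)
      qed
      then have "\<forall>\<^sub>F n in sequentially. \<bar>indicat_real (cbox a b) (x - r n *\<^sub>R u) - indicator (cbox a b) x\<bar> = 0"
        by eventually_elim simp
      then show ?case by (rule tendsto_eventually)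
    qed
  qed (auto intro!: borel_measurable_abs borel_measurable_diff borel_measurable_indicator')
  then show ?thesis by simp
qed

lemma lborel_integral_translate:
  fixes g :: "'a::euclidean_space \<Rightarrow> real"
  assumes "g \<in> borel_measurable borel"
  shows "(\<integral>x. g (x + c) \<partial>lborel) = (\<integral>x. g x \<partial>lborel)"
proof -
  have "(\<integral>x. g x \<partial>lborel) = (\<integral>x. g x \<partial>distr lborel borel ((+) c))"
    by (subst lborel_distr_plus) (rule refl)
  also have "\<dots> = (\<integral>x. g (c + x) \<partial>lborel)"
    by (rule integral_distr) (use assms in simp_all)
  finally show ?thesis by (simp add: add.commute)
qed

text \<open>
  The defect of additivity is a limit of differences \<open>q(x + u/n) - q(x)\<close> of bounded functions; by
  translation invariance their integrals over a box tend to 0.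
\<close>

lemma lipschitz_AE_dirderiv_add:
  fixes f :: "'a::euclidean_space \<Rightarrow> real"
  assumes lip: "L-lipschitz_on UNIV f"
  shows "AE x in lborel. \<forall>l m. has_dirderiv f u l x \<longrightarrow> has_dirderiv f v m x \<longrightarrow>
    has_dirderiv f (u + v) (l + m) x"
proof -
  have L: "L \<ge> 0" using lip by (rule lipschitz_on_nonneg)
  have cont: "continuous_on UNIV f" by (rule lipschitz_on_continuous_on[OF lip])
  have meas [measurable]: "(\<lambda>x. f (x + w)) \<in> borel_measurable borel" for w
    by (intro borel_measurable_continuous_onI continuous_on_compose2[OF cont] continuous_intros) auto
  have [measurable]: "f \<in> borel_measurable borel" using meas[of 0] by simp
  define r where "r = (\<lambda>n. inverse (real (Suc n)))"
  have r: "r \<longlonglongrightarrow> 0" "\<And>n. \<bar>r n\<bar> \<le> 1" "\<And>n. r n > 0" "\<And>n. r n * real (Suc n) = 1"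
    unfolding r_def using LIMSEQ_inverse_real_of_nat by (auto simp: divide_simps)
  define q where "q = (\<lambda>w n x. real (Suc n) * (f (x + r n *\<^sub>R w) - f x))"
  have qlim: "(\<lambda>n. q w n x) \<longlonglongrightarrow> l" if "has_dirderiv f w l x" for w l x
    using has_dirderiv_LIMSEQ[OF that] by (simp add: q_def r_def)
  have [measurable]: "q w n \<in> borel_measurable borel" for w n
    unfolding q_def by measurable
  have qbound: "\<bar>q w n x\<bar> \<le> L * norm w" for w n x
  proof -
    have "\<bar>f (x + r n *\<^sub>R w) - f x\<bar> \<le> L * (r n * norm w)"
      using lipschitz_onD[OF lip, of "x + r n *\<^sub>R w" x] r(3)[of n] by (simp add: dist_norm)
    then have "\<bar>q w n x\<bar> \<le> real (Suc n) * (L * (r n * norm w))"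
      unfolding q_def abs_mult by (intro mult_mono) auto
    also have "\<dots> = (r n * real (Suc n)) * (L * norm w)" by (simp only: mult_ac)
    finally show ?thesis using r(4)[of n] by (simp del: of_nat_Suc)
  qed
  define d where "d = (\<lambda>n x. q (u + v) n x - q u n x - q v n x)"
  have [measurable]: "d n \<in> borel_measurable borel" for n
    unfolding d_def by measurable
  \<comment> \<open>The step by \<open>u + v\<close> is a step by \<open>u\<close> followed by one
    by \<open>v\<close>; the first part cancels against \<open>q u n x\<close>.\<close>
  have d_eq: "d n x = q v n (x + r n *\<^sub>R u) - q v n x" for n x
    by (simp add: d_def q_def algebra_simps)
  \<comment> \<open>\<open>lim\<close> is unspecified where the sequence diverges, which happens on
    a null set only, and it gives a Borel function.\<close>
  define E where "E = (\<lambda>x. lim (\<lambda>n. d n x))"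
  have [measurable]: "E \<in> borel_measurable borel"
    unfolding E_def by (rule borel_measurable_lim_metric) simp
  have AEd: "AE x in lborel. (\<lambda>n. d n x) \<longlonglongrightarrow> E x"
    using lipschitz_AE_dirderiv[OF lip, of u] lipschitz_AE_dirderiv[OF lip, of v]
      lipschitz_AE_dirderiv[OF lip, of "u + v"]
  proof eventually_elim
    case (elim x)
    then obtain l m k where "has_dirderiv f u l x" "has_dirderiv f v m x" "has_dirderiv f (u + v) k x"
      by blast
    then have "(\<lambda>n. d n x) \<longlonglongrightarrow> k - l - m"
      unfolding d_def by (intro tendsto_intros qlim)
    then show ?case unfolding E_def by (simp add: limI)
  qed
  define C where "C = 2 * (L * norm v)"
  have dbound: "\<bar>d n x\<bar> \<le> C" for n x
    using qbound[of v n x] qbound[of v n "x + r n *\<^sub>R u"] by (simp add: d_eq C_def)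
  have Ebound: "AE x in lborel. \<bar>E x\<bar> \<le> C"
    using AEd
  proof eventually_elim
    case (elim x)
    show ?case by (rule tendsto_upperbound[OF tendsto_rabs[OF elim]]) (auto simp: dbound)
  qed
  have box0: "(E has_integral 0) (cbox a b)" for a b
  proof -
    let ?I = "indicat_real (cbox a b)"
    have intI: "integrable lborel (indicat_real (cbox c d))" for c d :: 'a
      using emeasure_lborel_cbox_finite by (intro integrable_real_indicator) auto
    have intIw: "integrable lborel (\<lambda>x. ?I x * g x)"
      if [measurable]: "g \<in> borel_measurable borel" and "AE x in lborel. \<bar>g x\<bar> \<le> K" for g K
    proof (rule Bochner_Integration.integrable_bound)
      show "integrable lborel (\<lambda>x. K * ?I x)" by (intro integrable_mult_right intI)
      show "AE x in lborel. norm (?I x * g x) \<le> norm (K * ?I x)"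
        using that(2) by eventually_elim (auto simp: indicator_def)
    qed auto
    have lim1: "(\<lambda>n. \<integral>x. ?I x * d n x \<partial>lborel) \<longlonglongrightarrow> (\<integral>x. ?I x * E x \<partial>lborel)"
    proof (rule integral_dominated_convergence[where w = "\<lambda>x. C * ?I x"])
      show "integrable lborel (\<lambda>x. C * ?I x)" by (intro integrable_mult_right intI)
      show "AE x in lborel. (\<lambda>n. ?I x * d n x) \<longlonglongrightarrow> ?I x * E x"
        using AEd by eventually_elim (intro tendsto_intros)
      show "AE x in lborel. norm (?I x * d n x) \<le> C * ?I x" for n
        using dbound by (auto simp: indicator_def)
    qed auto
    have "\<bar>\<integral>x. ?I x * d n x \<partial>lborel\<bar> \<le> L * norm v * (\<integral>x. \<bar>?I (x - r n *\<^sub>R u) - ?I x\<bar> \<partial>lborel)" for n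
    proof -
      have "?I (x - r n *\<^sub>R u) = indicator (cbox (a + r n *\<^sub>R u) (b + r n *\<^sub>R u)) x" for x
        by (auto simp: indicator_def mem_box inner_left_distrib inner_diff_left algebra_simps)
      then have I2: "integrable lborel (\<lambda>x. ?I (x - r n *\<^sub>R u))"
        by (simp only: intI)
      have I2q: "integrable lborel (\<lambda>x. ?I (x - r n *\<^sub>R u) * q v n x)"
        by (rule Bochner_Integration.integrable_bound[OF integrable_mult_right[OF I2, of "L * norm v"]])
          (use order_trans[OF qbound[of v n] abs_ge_self] in \<open>auto simp: indicator_def\<close>)
      have Iq: "integrable lborel (\<lambda>x. ?I x * q v n x)"
        by (rule intIw[of _ "L * norm v"]) (auto simp: qbound)
      have Iq': "integrable lborel (\<lambda>x. ?I x * q v n (x + r n *\<^sub>R u))"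
        by (rule intIw[of _ "L * norm v"]) (auto simp: qbound)
      have "(\<integral>x. ?I x * d n x \<partial>lborel) = (\<integral>x. ?I x * q v n (x + r n *\<^sub>R u) \<partial>lborel) - (\<integral>x. ?I x * q v n x \<partial>lborel)"
        unfolding d_eq right_diff_distrib by (rule Bochner_Integration.integral_diff[OF Iq' Iq])
      \<comment> \<open>A change of variables moves the shift from the quotient to the indicator.
        What remains is a factor bounded uniformly in \<open>n\<close> times a difference of
        indicators that tends to 0 in \<open>L1\<close>.\<close>
      also have "(\<integral>x. ?I x * q v n (x + r n *\<^sub>R u) \<partial>lborel) = (\<integral>x. ?I (x - r n *\<^sub>R u) * q v n x \<partial>lborel)"
        using lborel_integral_translate[of "\<lambda>x. ?I (x - r n *\<^sub>R u) * q v n x" "r n *\<^sub>R u"] by simp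
      also have "\<dots> - (\<integral>x. ?I x * q v n x \<partial>lborel) = (\<integral>x. (?I (x - r n *\<^sub>R u) - ?I x) * q v n x \<partial>lborel)"
        unfolding left_diff_distrib by (rule Bochner_Integration.integral_diff[OF I2q Iq, symmetric])
      finally have "\<bar>\<integral>x. ?I x * d n x \<partial>lborel\<bar> \<le> (\<integral>x. \<bar>(?I (x - r n *\<^sub>R u) - ?I x) * q v n x\<bar> \<partial>lborel)"
        using integral_abs_bound by simp
      also have "\<dots> \<le> (\<integral>x. (L * norm v) * \<bar>?I (x - r n *\<^sub>R u) - ?I x\<bar> \<partial>lborel)"
      proof (rule integral_mono)
        show "integrable lborel (\<lambda>x. \<bar>(?I (x - r n *\<^sub>R u) - ?I x) * q v n x\<bar>)"
          unfolding left_diff_distrib by (intro integrable_abs Bochner_Integration.integrable_diff I2q Iq)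
        show "integrable lborel (\<lambda>x. (L * norm v) * \<bar>?I (x - r n *\<^sub>R u) - ?I x\<bar>)"
          by (intro integrable_mult_right integrable_abs Bochner_Integration.integrable_diff I2 intI)
        show "\<bar>(?I (x - r n *\<^sub>R u) - ?I x) * q v n x\<bar> \<le> (L * norm v) * \<bar>?I (x - r n *\<^sub>R u) - ?I x\<bar>" for x
          unfolding abs_mult by (subst mult.commute) (intro mult_right_mono qbound abs_ge_zero)
      qed
      finally show ?thesis by simp
    qed
    then have "\<forall>\<^sub>F n in sequentially. norm (\<integral>x. ?I x * d n x \<partial>lborel)
        \<le> L * norm v * (\<integral>x. \<bar>?I (x - r n *\<^sub>R u) - ?I x\<bar> \<partial>lborel)" by simp
    moreover have "(\<lambda>n. L * norm v * (\<integral>x. \<bar>?I (x - r n *\<^sub>R u) - ?I x\<bar> \<partial>lborel)) \<longlonglongrightarrow> 0"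
      using tendsto_mult_left[OF L1_translate_indicator_cbox[OF r(1,2)], of "L * norm v" a b u] by simp
    ultimately have "(\<lambda>n. \<integral>x. ?I x * d n x \<partial>lborel) \<longlonglongrightarrow> 0"
      by (rule Lim_null_comparison)
    then have "(\<integral>x. ?I x * E x \<partial>lborel) = 0" by (rule LIMSEQ_unique[OF lim1])
    moreover have si: "set_integrable lborel (cbox a b) E"
      unfolding set_integrable_def using intIw[OF _ Ebound] by simp
    ultimately have "integral (cbox a b) E = 0"
      using set_borel_integral_eq_integral(2)[OF si] by (simp add: set_lebesgue_integral_def)
    then show ?thesis
      using integrable_integral[OF set_borel_integral_eq_integral(1)[OF si]] by simp
  qed
  show ?thesis
    using AE_zero_if_cbox_integrals_zero[OF box0] AEd lipschitz_AE_dirderiv[OF lip, of "u + v"]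
  proof eventually_elim
    case (elim x)
    show ?case
    proof (intro allI impI)
      fix l m assume lm: "has_dirderiv f u l x" "has_dirderiv f v m x"
      obtain k where k: "has_dirderiv f (u + v) k x" using elim by blast
      have "(\<lambda>n. d n x) \<longlonglongrightarrow> k - l - m"
        unfolding d_def using lm k by (intro tendsto_intros qlim)
      then have "k - l - m = 0" using elim(1) LIMSEQ_unique[OF elim(2)] by simp
      with k show "has_dirderiv f (u + v) (l + m) x" by (simp add: algebra_simps)
    qed
  qed
qed

text \<open>Nonnegative factors are immediate. For negative ones, additivity applied to
  \<open>w\<close> and \<open>- w\<close>, whose sum has derivative 0, shows that the derivatives in
  opposite directions are opposite.\<close>

lemma lipschitz_AE_dirderiv_scale:
  fixes f :: "'a::euclidean_space \<Rightarrow> real"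
  assumes lip: "L-lipschitz_on UNIV f"
  shows "AE x in lborel. \<forall>l. has_dirderiv f w l x \<longrightarrow> has_dirderiv f (r *\<^sub>R w) (r * l) x"
proof (cases "r \<ge> 0")
  case True
  then show ?thesis by (simp add: has_dirderiv_scale)
next
  case False
  show ?thesis
    using lipschitz_AE_dirderiv[OF lip, of "- w"] lipschitz_AE_dirderiv_add[OF lip, of w "- w"]
  proof eventually_elim
    case (elim x)
    then obtain m where m: "has_dirderiv f (- w) m x" by blast
    show ?case
    proof (intro allI impI)
      fix l assume "has_dirderiv f w l x"
      with elim(2) m have "has_dirderiv f (w + - w) (l + m) x" by blast
      moreover have "has_dirderiv f (w + - w) 0 x" by (simp add: has_dirderiv_def)
      ultimately have "m = - l" using has_dirderiv_unique by fastforce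
      with has_dirderiv_scale[OF m, of "- r"] False show "has_dirderiv f (r *\<^sub>R w) (r * l) x" by simp
    qed
  qed
qed

definition dirderiv :: "('a::real_normed_vector \<Rightarrow> real) \<Rightarrow> 'a \<Rightarrow> 'a \<Rightarrow> real" where
  "dirderiv f w x = (THE l. has_dirderiv f w l x)"

lemma dirderiv_eq: "has_dirderiv f w l x \<Longrightarrow> dirderiv f w x = l"
  unfolding dirderiv_def using has_dirderiv_unique by blast

text \<open>Induction over the basis vectors, each of which adds finitely many null sets. The
  exceptional set still depends on \<open>w\<close>.\<close>

lemma lipschitz_AE_dirderiv_linear:
  fixes f :: "'a::euclidean_space \<Rightarrow> real"
  assumes lip: "L-lipschitz_on UNIV f"
  shows "AE x in lborel. has_dirderiv f w (\<Sum>b\<in>Basis. (w \<bullet> b) * dirderiv f b x) x"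
proof -
  have "AE x in lborel. has_dirderiv f (\<Sum>b\<in>S. (w \<bullet> b) *\<^sub>R b) (\<Sum>b\<in>S. (w \<bullet> b) * dirderiv f b x) x"
    if "finite S" for S :: "'a set"
    using that
  proof induction
    case empty
    then show ?case by (simp add: has_dirderiv_def)
  next
    case (insert b S)
    show ?case
      using insert.IH lipschitz_AE_dirderiv[OF lip, of b]
        lipschitz_AE_dirderiv_scale[OF lip, of b "w \<bullet> b"]
        lipschitz_AE_dirderiv_add[OF lip, of "(w \<bullet> b) *\<^sub>R b" "\<Sum>b\<in>S. (w \<bullet> b) *\<^sub>R b"]
    proof eventually_elim
      case (elim x)
      then show ?case using insert.hyps dirderiv_eq by fastforce
    qed
  qed
  from this[OF finite_Basis] show ?thesis by (simp add: euclidean_representation)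
qed

section \<open>From directional derivatives to the full derivative\<close>

text \<open>By compactness finitely many directions from \<open>W\<close> are close to every unit
  vector. The quotients converge uniformly over these finitely many directions, and the Lipschitz
  bound carries the estimate to all others.\<close>

lemma has_derivative_if_dirderiv_dense:
  fixes f :: "'a::euclidean_space \<Rightarrow> real"
  assumes lip: "L-lipschitz_on UNIV f"
    and lin: "bounded_linear D"
    and dense: "\<And>U. open U \<Longrightarrow> U \<noteq> {} \<Longrightarrow> \<exists>w\<in>W. w \<in> U"
    and dir: "\<And>w. w \<in> W \<Longrightarrow> has_dirderiv f w (D w) x"
  shows "(f has_derivative D) (at x)"
  unfolding has_derivative_within_alt
proof (intro conjI allI impI lin)
  fix e :: real assume e: "e > 0"
  have L: "L \<ge> 0" using lip by (rule lipschitz_on_nonneg)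
  obtain K where K: "K > 0" "\<And>w. norm (D w) \<le> norm w * K"
    using bounded_linear.pos_bounded[OF lin] by blast
  \<comment> \<open>Replacing a unit vector \<open>w\<close> by a nearby \<open>d\<close> costs
    \<open>L * \<eta>\<close> in \<open>f\<close> and \<open>K * \<eta>\<close> in \<open>D\<close>,
    and the quotient in direction \<open>d\<close> is off by \<open>\<eta>\<close>. The three errors
    add up to \<open>e\<close>.\<close>
  define \<eta> where "\<eta> = e / (L + K + 1)"
  have pos: "L + K + 1 > 0" using L K by simp
  then have \<eta>0: "\<eta> > 0" using e by (simp add: \<eta>_def)
  have "L * \<eta> + \<eta> + K * \<eta> = (L + K + 1) * \<eta>" by (simp add: algebra_simps)
  also have "\<dots> = e" using pos by (simp add: \<eta>_def)
  finally have \<eta>: "\<eta> > 0" "L * \<eta> + \<eta> + K * \<eta> = e" using \<eta>0 by auto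
  have "cball 0 1 \<subseteq> (\<Union>d\<in>W. ball d \<eta>)"
  proof
    fix w :: 'a
    show "w \<in> (\<Union>d\<in>W. ball d \<eta>)" using dense[of "ball w \<eta>"] \<eta> by (auto simp: dist_commute)
  qed
  then obtain F where F: "F \<subseteq> W" "finite F" "cball 0 1 \<subseteq> (\<Union>d\<in>F. ball d \<eta>)"
    by (rule compactE_image[OF compact_cball open_ball])
  have "\<forall>\<^sub>F s in at_right 0. \<forall>d\<in>F. dist ((f (x + s *\<^sub>R d) - f x) / s) (D d) < \<eta>"
    using F dir \<eta> by (auto simp: eventually_ball_finite_distrib has_dirderiv_def intro!: tendstoD)
  then obtain \<delta> where \<delta>: "\<delta> > 0" "\<And>s d. 0 < s \<Longrightarrow> s < \<delta> \<Longrightarrow> d \<in> F \<Longrightarrow> dist ((f (x + s *\<^sub>R d) - f x) / s) (D d) < \<eta>"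
    unfolding eventually_at_right_field by blast
  have "norm (f y - f x - D (y - x)) \<le> e * norm (y - x)" if "norm (y - x) < \<delta>" for y
  proof (cases "y = x")
    case True
    then show ?thesis using linear_0[OF bounded_linear.linear[OF lin]] by simp
  next
    case False
    define s where "s = norm (y - x)"
    have s: "s > 0" "s < \<delta>" using False that by (auto simp: s_def)
    define w where "w = (y - x) /\<^sub>R s"
    have y: "y = x + s *\<^sub>R w" using s by (simp add: w_def)
    have "norm w = 1" using s by (simp add: w_def s_def)
    then have "w \<in> (\<Union>d\<in>F. ball d \<eta>)" using F(3) by (auto simp: subset_iff)
    then obtain d where d: "d \<in> F" "norm (w - d) < \<eta>" by (auto simp: dist_norm norm_minus_commute)
    have "\<bar>f (x + s *\<^sub>R w) - f (x + s *\<^sub>R d)\<bar> \<le> L * (s * norm (w - d))"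
      using lipschitz_onD[OF lip, of "x + s *\<^sub>R w" "x + s *\<^sub>R d"] s
      by (simp add: dist_norm flip: scaleR_diff_right)
    also have "\<dots> \<le> L * (s * \<eta>)" using L s d by (intro mult_left_mono) auto
    finally have 1: "\<bar>f (x + s *\<^sub>R w) - f (x + s *\<^sub>R d)\<bar> \<le> s * (L * \<eta>)" by (simp add: mult_ac)
    have "f (x + s *\<^sub>R d) - f x - s * D d = s * ((f (x + s *\<^sub>R d) - f x) / s - D d)"
      using s by (simp add: field_simps)
    then have "\<bar>f (x + s *\<^sub>R d) - f x - s * D d\<bar> = s * \<bar>(f (x + s *\<^sub>R d) - f x) / s - D d\<bar>"
      using s by (simp add: abs_mult)
    also have "\<dots> \<le> s * \<eta>"
      using \<delta>(2)[OF s d(1)] s by (intro mult_left_mono) (auto simp: dist_real_def)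
    finally have 2: "\<bar>f (x + s *\<^sub>R d) - f x - s * D d\<bar> \<le> s * \<eta>" .
    have "\<bar>D d - D w\<bar> \<le> norm (w - d) * K"
      using K(2)[of "d - w"] by (simp add: linear_diff[OF bounded_linear.linear[OF lin]] norm_minus_commute)
    also have "\<dots> \<le> \<eta> * K" using K d by (intro mult_right_mono) auto
    finally have "s * \<bar>D d - D w\<bar> \<le> s * (\<eta> * K)" using s by (intro mult_left_mono) auto
    moreover have "\<bar>s * D d - s * D w\<bar> = s * \<bar>D d - D w\<bar>"
      using s by (simp add: abs_mult flip: right_diff_distrib)
    ultimately have 3: "\<bar>s * D d - s * D w\<bar> \<le> s * (\<eta> * K)" by simp
    have "f y - f x - D (y - x) = (f (x + s *\<^sub>R w) - f (x + s *\<^sub>R d))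
        + (f (x + s *\<^sub>R d) - f x - s * D d) + (s * D d - s * D w)"
      by (simp add: y linear_scale[OF bounded_linear.linear[OF lin]])
    also have "\<bar>\<dots>\<bar> \<le> s * (L * \<eta>) + s * \<eta> + s * (\<eta> * K)"
      using 1 2 3 by linarith
    also have "\<dots> = s * (L * \<eta> + \<eta> + K * \<eta>)" by (simp add: algebra_simps)
    finally show ?thesis unfolding \<eta>(2) by (simp add: s_def mult.commute)
  qed
  then show "\<exists>d>0. \<forall>y\<in>UNIV. norm (y - x) < d \<longrightarrow> norm (f y - f x - D (y - x)) \<le> e * norm (y - x)"
    using \<delta>(1) by blast
qed

theorem rademacher:
  fixes f :: "'a::euclidean_space \<Rightarrow> 'b::euclidean_space"
  assumes lip: "L-lipschitz_on UNIV f"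
  shows "AE x in lborel. f differentiable (at x)"
proof -
  have "AE x in lborel. (\<lambda>x. f x \<bullet> i) differentiable (at x)" if "i \<in> Basis" for i
  proof -
    let ?g = "\<lambda>x. f x \<bullet> i"
    have lip': "L-lipschitz_on UNIV ?g"
    proof (rule lipschitz_onI)
      fix x y
      have "dist (?g x) (?g y) \<le> dist (f x) (f y)"
        using Basis_le_norm[OF that, of "f x - f y"] by (simp add: dist_norm inner_diff_left)
      also have "\<dots> \<le> L * dist x y" using lipschitz_onD[OF lip] by simp
      finally show "dist (?g x) (?g y) \<le> L * dist x y" .
    qed (rule lipschitz_on_nonneg[OF lip])
    \<comment> \<open>For countably many directions the exceptional sets have a null union, so one
      null set serves all of \<open>W\<close>.\<close>
    obtain W :: "'a set" where W: "countable W" "\<And>U. open U \<Longrightarrow> U \<noteq> {} \<Longrightarrow> \<exists>w\<in>W. w \<in> U"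
      using countable_dense_exists[where 'a = 'a] by blast
    have "AE x in lborel. \<forall>w\<in>W. has_dirderiv ?g w (\<Sum>b\<in>Basis. (w \<bullet> b) * dirderiv ?g b x) x"
      using W(1) lipschitz_AE_dirderiv_linear[OF lip'] by (subst AE_ball_countable) auto
    then show ?thesis
    proof eventually_elim
      case (elim x)
      have "bounded_linear (\<lambda>w. \<Sum>b\<in>Basis. (w \<bullet> b) * dirderiv ?g b x)"
        by (intro bounded_linear_intros)
      from has_derivative_if_dirderiv_dense[OF lip' this W(2)] elim
      show ?case by (auto simp: differentiable_def)
    qed
  qed
  then have "AE x in lborel. \<forall>i\<in>Basis. (\<lambda>x. f x \<bullet> i) differentiable (at x)"
    by (subst AE_finite_all) auto
  then show ?thesis
    by eventually_elim (rule differentiable_componentwise_within[THEN iffD2])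
qed

section \<open>Strongly convex functions\<close>

lemma lower_semicontinuous_iff:
  "lower_semicontinuous f \<longleftrightarrow> (\<forall>x. \<forall>a<f x. \<forall>\<^sub>F z in nhds x. a < f z)"
  unfolding lower_semicontinuous_def le_Liminf_iff by blast

lemma lower_semicontinuous_add_continuous:
  fixes f :: "'a::t2_space \<Rightarrow> ereal"
  assumes lsc: "lower_semicontinuous f" and cont: "continuous_on UNIV k"
  shows "lower_semicontinuous (\<lambda>x. f x + ereal (k x))"
  unfolding lower_semicontinuous_iff
proof (intro allI impI)
  fix x a assume "a < f x + ereal (k x)"
  then have "a - ereal (k x) < f x" by (subst ereal_minus_less) auto
  then obtain b where b: "a - ereal (k x) < ereal b" "ereal b < f x" using ereal_dense2 by blast
  then have a: "a < ereal (b + k x)" by (subst (asm) ereal_minus_less) (auto simp: add.commute)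
  have "((\<lambda>z. ereal (b + k z)) \<longlongrightarrow> ereal (b + k x)) (nhds x)"
    using cont by (intro tendsto_intros)
      (metis UNIV_I continuous_on_eq_continuous_at isCont_def open_UNIV tendsto_at_iff_tendsto_nhds)
  from order_tendstoD(1)[OF this a] lsc[unfolded lower_semicontinuous_iff, rule_format, OF b(2)]
  show "\<forall>\<^sub>F z in nhds x. a < f z + ereal (k z)"
  proof eventually_elim
    case (elim z)
    have "ereal (b + k z) \<le> f z + ereal (k z)"
      using elim(2) by (simp add: add_right_mono flip: plus_ereal.simps(1))
    with elim(1) show ?case by (rule less_le_trans)
  qed
qed

text \<open>Without a minimizer the open sets where \<open>f\<close> exceeds \<open>f p\<close>, for
  \<open>p\<close> in \<open>K\<close>, cover \<open>K\<close>. A finite subcover misses the centre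
  \<open>q\<close> with the least value.\<close>

lemma lower_semicontinuous_attains_min:
  fixes f :: "'a::topological_space \<Rightarrow> ereal"
  assumes lsc: "lower_semicontinuous f" and K: "compact K" "K \<noteq> {}"
  shows "\<exists>p\<in>K. \<forall>x\<in>K. f p \<le> f x"
proof (rule ccontr)
  assume "\<not> ?thesis"
  then have cover: "K \<subseteq> (\<Union>p\<in>K. {x. f p < f x})" by (auto simp: not_le)
  have op: "open {x. a < f x}" for a
  proof (subst open_subopen, intro ballI)
    fix x assume "x \<in> {x. a < f x}"
    then have "\<forall>\<^sub>F z in nhds x. a < f z" using lsc by (simp add: lower_semicontinuous_iff)
    then show "\<exists>T. open T \<and> x \<in> T \<and> T \<subseteq> {x. a < f x}" unfolding eventually_nhds by blast
  qed
  obtain F where F: "F \<subseteq> K" "finite F" "K \<subseteq> (\<Union>p\<in>F. {x. f p < f x})"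
    by (rule compactE_image[OF K(1) op cover])
  with K(2) have "F \<noteq> {}" by auto
  then obtain q where q: "q \<in> F" "\<forall>p\<in>F. f q \<le> f p"
    using F(2) by (metis arg_min_if_finite(1) arg_min_least)
  with F obtain p where "p \<in> F" "f p < f q" by blast
  with q show False by (auto simp: not_le[symmetric])
qed

lemma s_convex_realD:
  assumes "s_convex s f" "f x = ereal a" "f y = ereal b" "0 < l" "l < 1"
  shows "f ((1 - l) *\<^sub>R x + l *\<^sub>R y) \<le> ereal ((1 - l) * a + l * b - s / 2 * l * (1 - l) * (norm (x - y))\<^sup>2)"
  using assms(1)[unfolded s_convex_def, rule_format, of l x y] assms(2-) by simp

lemma norm_convex_combination_power2:
  fixes x y :: "'a::real_inner"
  shows "(norm ((1 - l) *\<^sub>R x + l *\<^sub>R y))\<^sup>2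
    = (1 - l) * (norm x)\<^sup>2 + l * (norm y)\<^sup>2 - l * (1 - l) * (norm (x - y))\<^sup>2"
  by (simp add: power2_norm_eq_inner inner_simps inner_commute algebra_simps)

text \<open>The quadratic term satisfies the inequality of modulus \<open>c\<close> with equality,
  and the linear term does not affect the modulus.\<close>

lemma s_convex_add_quadratic:
  fixes f :: "'a::real_inner \<Rightarrow> ereal"
  assumes "s_convex s f" and nm: "\<And>x. f x \<noteq> -\<infinity>"
  shows "s_convex (s + c) (\<lambda>x. f x + ereal (c / 2 * (norm x)\<^sup>2 - y \<bullet> x))"
  unfolding s_convex_def
proof (intro allI impI)
  fix u v :: 'a and l :: real assume l: "0 < l \<and> l < 1"
  let ?z = "(1 - l) *\<^sub>R u + l *\<^sub>R v" and ?k = "\<lambda>x. c / 2 * (norm x)\<^sup>2 - y \<bullet> x"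
  let ?R = "ereal (1 - l) * (f u + ereal (?k u)) + ereal l * (f v + ereal (?k v))
      - ereal ((s + c) / 2 * l * (1 - l) * (norm (u - v))\<^sup>2)"
  show "f ?z + ereal (?k ?z) \<le> ?R"
  proof (cases "f u = \<infinity> \<or> f v = \<infinity>")
    case True
    then have "?R = \<infinity>"
      using l nm[of u] nm[of v] by (cases "f u"; cases "f v") auto
    then show ?thesis by simp
  next
    case False
    then obtain a b where ab: "f u = ereal a" "f v = ereal b"
      using nm[of u] nm[of v] by (cases "f u"; cases "f v") auto
    have k: "?k ?z = (1 - l) * ?k u + l * ?k v - c / 2 * l * (1 - l) * (norm (u - v))\<^sup>2"
      unfolding norm_convex_combination_power2
      by (simp add: inner_simps algebra_simps diff_divide_distrib add_divide_distrib)
    have "f ?z + ereal (?k ?z) \<le>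
      ereal ((1 - l) * a + l * b - s / 2 * l * (1 - l) * (norm (u - v))\<^sup>2) + ereal (?k ?z)"
      using s_convex_realD[OF assms(1) ab] l by (intro add_right_mono) auto
    also have "\<dots> = ?R"
      unfolding k using ab by (simp add: algebra_simps add_divide_distrib)
    finally show ?thesis .
  qed
qed

text \<open>A minimizer over a large ball is global because strong convexity makes \<open>f\<close>
  at least \<open>f x0\<close> outside. The quadratic growth comes from comparing \<open>p\<close>
  with points on the segment towards \<open>x\<close>, close to \<open>p\<close>.\<close>

lemma strongly_convex_minimizer:
  fixes f :: "'a::euclidean_space \<Rightarrow> ereal"
  assumes nm: "\<And>x. f x \<noteq> -\<infinity>" and proper: "proper f" and lsc: "lower_semicontinuous f"
    and conv: "s_convex m f" and m: "m > 0"
  shows "\<exists>p. f p < \<infinity> \<and> (\<forall>x. f p + ereal (m / 2 * (norm (x - p))\<^sup>2) \<le> f x)"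
proof -
  obtain x0 f0 where x0: "f x0 = ereal f0"
  proof -
    obtain x where "f x < \<infinity>" using proper by (auto simp: proper_def edom_def)
    then show thesis using nm[of x] that by (cases "f x") auto
  qed
  obtain q where q: "q \<in> cball x0 1" "\<And>x. x \<in> cball x0 1 \<Longrightarrow> f q \<le> f x"
    using lower_semicontinuous_attains_min[OF lsc compact_cball, of x0 1] by auto
  have "f q \<le> ereal f0" using q(2)[of x0] x0 by simp
  then obtain b where b: "f q = ereal b" "b \<le> f0" using nm[of q] by (cases "f q") auto
  \<comment> \<open>For \<open>r > R\<close> the gain \<open>m / 2 * (r - 1)\<close> from strong
    convexity exceeds the possible drop \<open>f0 - b\<close> of \<open>f\<close> on the unit ball
    around \<open>x0\<close>.\<close>
  define R where "R = 1 + 2 * (f0 - b) / m"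
  have R: "R \<ge> 1" using b m by (simp add: R_def)
  obtain p where p: "p \<in> cball x0 R" "\<And>x. x \<in> cball x0 R \<Longrightarrow> f p \<le> f x"
    using lower_semicontinuous_attains_min[OF lsc compact_cball, of x0 R] R by auto
  have pf0: "f p \<le> ereal f0" using p(2)[of x0] R x0 by simp
  have min: "f p \<le> f x" for x
  proof (cases "x \<in> cball x0 R \<or> f x = \<infinity>")
    case True
    then show ?thesis using p(2) by auto
  next
    case False
    then obtain a where a: "f x = ereal a" using nm[of x] by (cases "f x") auto
    define r where "r = norm (x0 - x)"
    have r: "r > R" "r > 1" using False R by (auto simp: r_def dist_norm)
    \<comment> \<open>With this weight the convex combination lies at distance 1 from
      \<open>x0\<close>, where \<open>b\<close> bounds \<open>f\<close> from below.\<close>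
    define l where "l = 1 / r"
    have l: "0 < l" "l < 1" using r R by (auto simp: l_def)
    have "(1 - l) *\<^sub>R x0 + l *\<^sub>R x = x0 - l *\<^sub>R (x0 - x)" by (simp add: algebra_simps)
    moreover have "norm (l *\<^sub>R (x0 - x)) = l * r" using l by (simp add: r_def)
    moreover have "l * r = 1" using r by (simp add: l_def)
    ultimately have "(1 - l) *\<^sub>R x0 + l *\<^sub>R x \<in> cball x0 1" by (simp add: dist_norm)
    from order_trans[OF q(2)[OF this] s_convex_realD[OF conv x0 a l]] b(1)
    have "b \<le> (1 - l) * f0 + l * a - m / 2 * l * (1 - l) * r\<^sup>2" by (simp add: r_def)
    then have "r * b \<le> r * ((1 - l) * f0 + l * a - m / 2 * l * (1 - l) * r\<^sup>2)"
      using r by (intro mult_left_mono) auto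
    also have "\<dots> = (r - 1) * f0 + a - r * (m / 2 * (r - 1))"
      using r by (simp add: l_def field_simps power2_eq_square)
    finally have 1: "r * b \<le> (r - 1) * f0 + a - r * (m / 2 * (r - 1))" .
    have "f0 - b \<le> m / 2 * (r - 1)" using r(1) m by (simp add: R_def field_simps)
    then have 2: "r * (f0 - b) \<le> r * (m / 2 * (r - 1))" using r by (intro mult_left_mono) auto
    have "f0 = r * b + r * (f0 - b) - (r - 1) * f0" by (simp add: algebra_simps)
    also have "\<dots> \<le> ((r - 1) * f0 + a - r * (m / 2 * (r - 1))) + r * (m / 2 * (r - 1)) - (r - 1) * f0"
      by (intro diff_right_mono add_mono 1 2)
    also have "\<dots> = a" by simp
    finally have "f0 \<le> a" .
    then have "ereal f0 \<le> f x" using a by simp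
    with pf0 show ?thesis by (rule order_trans)
  qed
  obtain fp where fp: "f p = ereal fp" using pf0 nm[of p] by (cases "f p") auto
  have "f p + ereal (m / 2 * (norm (x - p))\<^sup>2) \<le> f x" for x
  proof (cases "f x = \<infinity>")
    case False
    then obtain a where a: "f x = ereal a" using nm[of x] by (cases "f x") auto
    \<comment> \<open>Minimality of \<open>p\<close> gives an inequality with a factor
      \<open>l\<close>; after division by it, \<open>l\<close> tends to 0 and the full constant
      \<open>m / 2\<close> is recovered.\<close>
    have "fp + m / 2 * (1 - l) * (norm (x - p))\<^sup>2 \<le> a" if l: "0 < l" "l < 1" for l
    proof -
      have "fp \<le> (1 - l) * fp + l * a - m / 2 * l * (1 - l) * (norm (p - x))\<^sup>2"
        using order_trans[OF min s_convex_realD[OF conv fp a l]] fp by simp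
      then have "l * (fp + m / 2 * (1 - l) * (norm (x - p))\<^sup>2) \<le> l * a"
        by (simp add: algebra_simps norm_minus_commute)
      then show ?thesis using l by simp
    qed
    then have "\<forall>\<^sub>F l in at_right 0. fp + m / 2 * (1 - l) * (norm (x - p))\<^sup>2 \<le> a"
      unfolding eventually_at_right_field by (intro exI[of _ 1]) auto
    moreover have "((\<lambda>l. fp + m / 2 * (1 - l) * (norm (x - p))\<^sup>2) \<longlongrightarrow>
        fp + m / 2 * (1 - 0) * (norm (x - p))\<^sup>2) (at_right 0)"
      by (intro tendsto_intros)
    ultimately have "fp + m / 2 * (norm (x - p))\<^sup>2 \<le> a"
      using tendsto_upperbound by fastforce
    then show ?thesis using fp a by simp
  qed simp
  then show ?thesis using fp by (intro exI[of _ p]) simp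
qed

lemma has_derivative_right_quotient:
  fixes f :: "'a::real_normed_vector \<Rightarrow> 'b::euclidean_space"
  assumes "(f has_derivative D) (at x)"
  shows "((\<lambda>t. (f (x + t *\<^sub>R u) - f x) /\<^sub>R t) \<longlongrightarrow> D u) (at_right 0)"
proof (subst tendsto_componentwise_iff, rule ballI)
  fix i :: 'b assume "i \<in> Basis"
  have "((\<lambda>t. x + t *\<^sub>R u) has_derivative (\<lambda>h. h *\<^sub>R u)) (at 0)"
    by (auto intro!: derivative_eq_intros)
  from has_derivative_compose[OF this, of f D]
  have "((\<lambda>t. f (x + t *\<^sub>R u)) has_derivative (\<lambda>h. D (h *\<^sub>R u))) (at 0)"
    using assms by simp
  then have "((\<lambda>t. f (x + t *\<^sub>R u) \<bullet> i) has_derivative (\<lambda>h. D (h *\<^sub>R u) \<bullet> i)) (at 0)"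
    by (rule has_derivative_inner_left)
  then have "((\<lambda>t. f (x + t *\<^sub>R u) \<bullet> i) has_real_derivative D u \<bullet> i) (at 0)"
    by (simp add: has_field_derivative_def linear_scale[OF has_derivative_linear[OF assms]] mult_commute_abs)
  then have "((\<lambda>t. (f (x + t *\<^sub>R u) \<bullet> i - f x \<bullet> i) / t) \<longlongrightarrow> D u \<bullet> i) (at 0)"
    by (simp add: DERIV_def)
  then show "((\<lambda>t. ((f (x + t *\<^sub>R u) - f x) /\<^sub>R t) \<bullet> i) \<longlongrightarrow> D u \<bullet> i) (at_right 0)"
    by (intro filterlim_mono[OF _ order_refl at_le[of "{0<..}" UNIV]])
      (simp_all add: inner_diff_left divide_inverse mult.commute)
qed

section \<open>The proximal map and the conjugate\<close>

locale weakly_convex_function =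
  fixes \<phi> :: "'a::euclidean_space \<Rightarrow> ereal" and \<rho> :: real
  assumes not_MInf: "\<And>x. \<phi> x \<noteq> -\<infinity>"
    and proper: "proper \<phi>"
    and lsc: "lower_semicontinuous \<phi>"
    and s_convex: "s_convex (- \<rho>) \<phi>"
    and rho_nonneg: "\<rho> \<ge> 0"

locale prox_parameter = weakly_convex_function +
  fixes c :: real
  assumes rho_less: "\<rho> < c"
begin

text \<open>In terms of \<open>f = \<phi> + c/2 |.|\<^sup>2\<close>, the following are \<open>\<nabla>f\<^sup>*\<close> and \<open>f\<^sup>*\<close>.\<close>

definition prox_point :: "'a \<Rightarrow> 'a" where
  "prox_point y = (SOME p. \<phi> p < \<infinity> \<and>
     (\<forall>x. \<phi> p + ereal (c / 2 * (norm p)\<^sup>2 - y \<bullet> p) + ereal ((c - \<rho>) / 2 * (norm (x - p))\<^sup>2)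
        \<le> \<phi> x + ereal (c / 2 * (norm x)\<^sup>2 - y \<bullet> x)))"

definition conj_fun :: "'a \<Rightarrow> real" where
  "conj_fun y = y \<bullet> prox_point y - c / 2 * (norm (prox_point y))\<^sup>2 - real_of_ereal (\<phi> (prox_point y))"

lemma c_pos: "c > 0"
  using rho_nonneg rho_less by simp

lemma prox_point_spec:
  "\<phi> (prox_point y) < \<infinity> \<and>
     (\<forall>x. \<phi> (prox_point y) + ereal (c / 2 * (norm (prox_point y))\<^sup>2 - y \<bullet> prox_point y)
         + ereal ((c - \<rho>) / 2 * (norm (x - prox_point y))\<^sup>2)
        \<le> \<phi> x + ereal (c / 2 * (norm x)\<^sup>2 - y \<bullet> x))"
  unfolding prox_point_def
proof (rule someI_ex)
  let ?f = "\<lambda>x. \<phi> x + ereal (c / 2 * (norm x)\<^sup>2 - y \<bullet> x)"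
  have "\<exists>p. ?f p < \<infinity> \<and> (\<forall>x. ?f p + ereal ((c - \<rho>) / 2 * (norm (x - p))\<^sup>2) \<le> ?f x)"
  proof (rule strongly_convex_minimizer)
    show "?f x \<noteq> -\<infinity>" for x using not_MInf[of x] by (cases "\<phi> x") auto
    obtain x where "\<phi> x < \<infinity>" using proper by (auto simp: proper_def edom_def)
    then show "proper ?f" by (auto simp: proper_def edom_def intro!: exI[of _ x])
    show "lower_semicontinuous ?f"
      by (intro lower_semicontinuous_add_continuous lsc continuous_intros)
    show "s_convex (c - \<rho>) ?f"
      using s_convex_add_quadratic[OF s_convex not_MInf, of c y] by simp
  qed (use rho_less in simp)
  then show "\<exists>p. \<phi> p < \<infinity> \<and> (\<forall>x. ?f p + ereal ((c - \<rho>) / 2 * (norm (x - p))\<^sup>2) \<le> ?f x)"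
    by auto
qed

lemma prox_value: "\<phi> (prox_point y) = ereal (real_of_ereal (\<phi> (prox_point y)))"
  using prox_point_spec[of y] not_MInf[of "prox_point y"] by (cases "\<phi> (prox_point y)") auto

text \<open>Growth at the minimizer, rewritten through \<open>conj_fun\<close>: the Fenchel
  inequality sharpened by the squared distance to \<open>prox_point y\<close>.\<close>

lemma quadratic_growth:
  "ereal (y \<bullet> x - c / 2 * (norm x)\<^sup>2 - conj_fun y + (c - \<rho>) / 2 * (norm (x - prox_point y))\<^sup>2) \<le> \<phi> x"
proof (cases "\<phi> x")
  case (real a)
  have "\<phi> (prox_point y) + ereal (c / 2 * (norm (prox_point y))\<^sup>2 - y \<bullet> prox_point y)
         + ereal ((c - \<rho>) / 2 * (norm (x - prox_point y))\<^sup>2)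
        \<le> \<phi> x + ereal (c / 2 * (norm x)\<^sup>2 - y \<bullet> x)"
    using prox_point_spec[of y] by blast
  then show ?thesis
    using real by (subst (asm) prox_value) (simp add: conj_fun_def algebra_simps)
qed (use not_MInf in auto)

lemma fenchel_young: "ereal (y \<bullet> x - c / 2 * (norm x)\<^sup>2 - conj_fun y) \<le> \<phi> x"
proof (rule order_trans[OF _ quadratic_growth[of y x]])
  have "(c - \<rho>) / 2 * (norm (x - prox_point y))\<^sup>2 \<ge> 0" using rho_less by simp
  then show "ereal (y \<bullet> x - c / 2 * (norm x)\<^sup>2 - conj_fun y)
    \<le> ereal (y \<bullet> x - c / 2 * (norm x)\<^sup>2 - conj_fun y + (c - \<rho>) / 2 * (norm (x - prox_point y))\<^sup>2)"
    by simp
qed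

lemma fenchel_young_eq:
  "\<phi> (prox_point y) = ereal (y \<bullet> prox_point y - c / 2 * (norm (prox_point y))\<^sup>2 - conj_fun y)"
  by (subst prox_value) (simp add: conj_fun_def)

text \<open>The sharpened inequality for \<open>y'\<close> is evaluated at
  \<open>prox_point y\<close>, where the Fenchel inequality for \<open>y\<close> is an
  equality.\<close>

lemma conj_fun_growth:
  "conj_fun y' \<ge> conj_fun y + prox_point y \<bullet> (y' - y) + (c - \<rho>) / 2 * (norm (prox_point y - prox_point y'))\<^sup>2"
  using quadratic_growth[of y' "prox_point y"] unfolding fenchel_young_eq
  by (simp add: inner_simps inner_commute)

lemma prox_point_monotone:
  "(c - \<rho>) * (norm (prox_point y - prox_point y'))\<^sup>2 \<le> (y - y') \<bullet> (prox_point y - prox_point y')"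
  using conj_fun_growth[of y y'] conj_fun_growth[of y' y]
  by (simp add: inner_simps inner_commute norm_minus_commute)

lemma prox_point_lipschitz: "(1 / (c - \<rho>))-lipschitz_on UNIV prox_point"
proof (rule lipschitz_onI)
  fix y y'
  let ?d = "norm (prox_point y - prox_point y')"
  have "(c - \<rho>) * ?d * ?d \<le> norm (y - y') * ?d"
    using prox_point_monotone[of y y'] norm_cauchy_schwarz[of "y - y'" "prox_point y - prox_point y'"]
    by (simp add: power2_eq_square)
  then have "(c - \<rho>) * ?d \<le> norm (y - y')"
    by (cases "?d = 0") (auto simp: mult_le_cancel_right)
  then show "dist (prox_point y) (prox_point y') \<le> 1 / (c - \<rho>) * dist y y'"
    using rho_less by (simp add: dist_norm field_simps)
qed (use rho_less in simp)

lemma conj_fun_lower: "conj_fun y + prox_point y \<bullet> (y' - y) \<le> conj_fun y'"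
proof -
  have "(c - \<rho>) / 2 * (norm (prox_point y - prox_point y'))\<^sup>2 \<ge> 0" using rho_less by simp
  with conj_fun_growth[of y y'] show ?thesis by linarith
qed

text \<open>The subgradient inequalities at \<open>y\<close> and at \<open>z\<close> squeeze the
  remainder between 0 and \<open>(prox_point z - prox_point y) \<bullet> (z - y)\<close>, which is
  quadratic in \<open>z - y\<close> by the Lipschitz bound.\<close>

lemma conj_fun_has_derivative: "(conj_fun has_derivative (\<lambda>h. prox_point y \<bullet> h)) (at y)"
  unfolding has_derivative_within_alt
proof (intro conjI allI impI)
  show "bounded_linear (\<lambda>h. prox_point y \<bullet> h)" by (rule bounded_linear_inner_right)
  fix e :: real assume e: "e > 0"
  have "norm (conj_fun z - conj_fun y - prox_point y \<bullet> (z - y)) \<le> e * norm (z - y)"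
    if z: "norm (z - y) < e * (c - \<rho>)" for z
  proof -
    have "norm (prox_point z - prox_point y) \<le> 1 / (c - \<rho>) * norm (z - y)"
      using lipschitz_onD[OF prox_point_lipschitz, of z y] by (simp add: dist_norm)
    also have "\<dots> \<le> e" using z rho_less by (simp add: field_simps)
    finally have "norm (prox_point z - prox_point y) \<le> e" .
    then have "(prox_point z - prox_point y) \<bullet> (z - y) \<le> e * norm (z - y)"
      using norm_cauchy_schwarz[of "prox_point z - prox_point y" "z - y"]
      by (meson mult_right_mono norm_ge_zero order_trans)
    then show ?thesis
      using conj_fun_lower[of y z] conj_fun_lower[of z y] by (simp add: inner_simps abs_le_iff)
  qed
  then show "\<exists>d>0. \<forall>z\<in>UNIV. norm (z - y) < d \<longrightarrow>
      norm (conj_fun z - conj_fun y - prox_point y \<bullet> (z - y)) \<le> e * norm (z - y)"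
    using e rho_less by (intro exI[of _ "e * (c - \<rho>)"]) auto
qed

text \<open>By l'Hopital's rule: the numerator has derivative
  \<open>(prox_point (y + t *\<^sub>R u) - prox_point y) \<bullet> u\<close>, and division by
  \<open>2 * t\<close> produces half the difference quotient of the gradient.\<close>

lemma conj_fun_second_order:
  assumes "(prox_point has_derivative M) (at y)"
  shows "((\<lambda>t. (conj_fun (y + t *\<^sub>R u) - conj_fun y - t * (prox_point y \<bullet> u)) / t\<^sup>2)
           \<longlongrightarrow> (M u \<bullet> u) / 2) (at_right 0)"
proof (rule lhopital_right_0)
  have dline: "((\<lambda>t. y + t *\<^sub>R u) has_derivative (\<lambda>h. h *\<^sub>R u)) (at t)" for t :: real
    by (auto intro!: derivative_eq_intros)
  have dg: "((\<lambda>t. conj_fun (y + t *\<^sub>R u) - conj_fun y - t * (prox_point y \<bullet> u)) has_real_derivative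
      (prox_point (y + t *\<^sub>R u) - prox_point y) \<bullet> u) (at t)" for t
  proof -
    have "((\<lambda>t. conj_fun (y + t *\<^sub>R u)) has_derivative (\<lambda>h. prox_point (y + t *\<^sub>R u) \<bullet> (h *\<^sub>R u))) (at t)"
      by (rule has_derivative_compose[OF dline conj_fun_has_derivative])
    then have "((\<lambda>t. conj_fun (y + t *\<^sub>R u)) has_real_derivative prox_point (y + t *\<^sub>R u) \<bullet> u) (at t)"
      by (simp add: has_field_derivative_def mult_commute_abs)
    then show ?thesis by (auto intro!: derivative_eq_intros simp: inner_diff_left)
  qed
  show "\<forall>\<^sub>F t in at_right 0. ((\<lambda>t. conj_fun (y + t *\<^sub>R u) - conj_fun y - t * (prox_point y \<bullet> u)) has_real_derivative
      (prox_point (y + t *\<^sub>R u) - prox_point y) \<bullet> u) (at t)"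
    using dg by simp
  show "((\<lambda>t. conj_fun (y + t *\<^sub>R u) - conj_fun y - t * (prox_point y \<bullet> u)) \<longlongrightarrow> 0) (at_right 0)"
    using DERIV_isCont[OF dg, of 0] by (auto simp: isCont_def intro: filterlim_mono at_le)
  show "\<forall>\<^sub>F t in at_right (0::real). ((\<lambda>t. t\<^sup>2) has_real_derivative 2 * t) (at t)"
    by (auto intro!: always_eventually derivative_eq_intros)
  show "((\<lambda>t::real. t\<^sup>2) \<longlongrightarrow> 0) (at_right 0)" by (auto intro!: tendsto_eq_intros)
  show "\<forall>\<^sub>F t in at_right (0::real). t\<^sup>2 \<noteq> 0" "\<forall>\<^sub>F t in at_right (0::real). 2 * t \<noteq> 0"
    by (auto simp: eventually_at_right_field intro: exI[of _ 1])
  have "((\<lambda>t. (prox_point (y + t *\<^sub>R u) - prox_point y) /\<^sub>R t) \<longlongrightarrow> M u) (at_right 0)"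
    by (rule has_derivative_right_quotient[OF assms])
  moreover have eq: "((prox_point (y + t *\<^sub>R u) - prox_point y) /\<^sub>R t) \<bullet> u / 2
      = ((prox_point (y + t *\<^sub>R u) - prox_point y) \<bullet> u) / (2 * t)" for t
    by (simp only: inner_scaleR_left) (simp only: divide_inverse inverse_mult_distrib mult_ac)
  ultimately have "((\<lambda>t. ((prox_point (y + t *\<^sub>R u) - prox_point y) /\<^sub>R t) \<bullet> u / 2) \<longlongrightarrow> M u \<bullet> u / 2) (at_right 0)"
    by (intro tendsto_divide tendsto_inner tendsto_const) simp_all
  then show "((\<lambda>t. ((prox_point (y + t *\<^sub>R u) - prox_point y) \<bullet> u) / (2 * t)) \<longlongrightarrow> M u \<bullet> u / 2) (at_right 0)"
    by (simp only: eq)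
qed

end

section \<open>Second subderivatives at proximal points\<close>

text \<open>On the epigraph the quotient defining regular normals is at most \<open>K\<close> times
  the distance to the base point, so its upper limit is at most 0. Constant sequences then give a
  limiting normal.\<close>

lemma subdiff_if_quadratic_minorant:
  assumes fin: "\<phi> x = ereal r" and K: "K \<ge> 0"
    and minor: "\<And>z. ereal (r + v \<bullet> (z - x) - K * (norm (z - x))\<^sup>2) \<le> \<phi> z"
  shows "v \<in> subdiff \<phi> x"
proof -
  let ?p = "(x, r)"
  have le: "((v, -1) \<bullet> (q - ?p)) / norm (q - ?p) \<le> K * norm (q - ?p)" if "q \<in> epi \<phi>" for q
  proof -
    obtain z \<alpha> where q: "q = (z, \<alpha>)" by (cases q)
    have "\<phi> z \<le> ereal \<alpha>" using that q by (simp add: epi_def)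
    from order_trans[OF minor this] have "r + v \<bullet> (z - x) - K * (norm (z - x))\<^sup>2 \<le> \<alpha>" by simp
    then have "(v, -1) \<bullet> (q - ?p) \<le> K * (norm (z - x))\<^sup>2" by (simp add: q)
    also have "\<dots> \<le> K * (norm (q - ?p))\<^sup>2"
      using K norm_fst_le[of "z - x" "\<alpha> - r"] by (intro mult_left_mono power_mono) (auto simp: q)
    finally show ?thesis
      by (cases "q = ?p") (auto simp: divide_le_eq power2_eq_square)
  qed
  have "Limsup (at ?p within epi \<phi>) (\<lambda>q. ereal (((v, -1) \<bullet> (q - ?p)) / norm (q - ?p))) \<le> 0"
  proof (rule ereal_le_epsilon2)
    fix e :: real assume e: "e > 0"
    have "\<forall>\<^sub>F q in at ?p within epi \<phi>. dist q ?p < e / (K + 1)"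
      using e K unfolding eventually_at by (intro exI[of _ "e / (K + 1)"]) auto
    moreover have "\<forall>\<^sub>F q in at ?p within epi \<phi>. q \<in> epi \<phi>"
      unfolding eventually_at by (intro exI[of _ 1]) auto
    ultimately have "\<forall>\<^sub>F q in at ?p within epi \<phi>. ereal (((v, -1) \<bullet> (q - ?p)) / norm (q - ?p)) \<le> 0 + ereal e"
    proof eventually_elim
      case (elim q)
      have "K * norm (q - ?p) \<le> (K + 1) * norm (q - ?p)" by (intro mult_right_mono) auto
      also have "\<dots> \<le> e" using elim(1) K by (simp add: dist_norm field_simps)
      finally show ?case using le[OF elim(2)] by simp
    qed
    then show "Limsup (at ?p within epi \<phi>) (\<lambda>q. ereal (((v, -1) \<bullet> (q - ?p)) / norm (q - ?p))) \<le> 0 + ereal e"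
      by (rule Limsup_bounded)
  qed
  then have "(v, -1) \<in> regular_normal_cone (epi \<phi>) ?p"
    by (simp add: regular_normal_cone_def)
  moreover have "?p \<in> epi \<phi>" using fin by (simp add: epi_def)
  ultimately have "(v, -1) \<in> limiting_normal_cone (epi \<phi>) ?p"
    unfolding limiting_normal_cone_def
    by (intro CollectI exI[of _ "\<lambda>_. ?p"] exI[of _ "\<lambda>_. (v, -1)"]) auto
  then show ?thesis using fin by (simp add: subdiff_def edom_def)
qed

text \<open>This yields upper bounds on second subderivatives from a single path along which the
  quotients converge.\<close>

lemma Liminf_le_lim_compose:
  fixes f :: "'a \<Rightarrow> ereal"
  assumes h: "filterlim h F G" and lim: "((\<lambda>t. f (h t)) \<longlongrightarrow> l) G" and G: "G \<noteq> bot"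
  shows "Liminf F f \<le> l"
proof (rule dense_le)
  fix y assume "y < Liminf F f"
  then have "\<forall>\<^sub>F t in G. y < f (h t)"
    using less_LiminfD filterlim_iff h by blast
  then show "y \<le> l"
    by (intro tendsto_lowerbound[OF lim _ G]) (auto elim: eventually_mono)
qed

text \<open>Taking \<open>u + s *\<^sub>R v\<close> for \<open>u'\<close> bounds \<open>s\<close>
  times the defect of symmetry \<open>a\<close> by a multiple of \<open>s^2\<close>, which forces
  \<open>a = 0\<close>.\<close>

lemma quadratic_polarization_symmetric:
  fixes M :: "'a::real_inner \<Rightarrow> 'a"
  assumes lin: "linear M" and le: "\<And>u u'. 2 * (M u \<bullet> u') - M u' \<bullet> u' \<le> M u \<bullet> u"
  shows "M u \<bullet> v = u \<bullet> M v"
proof -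
  define a where "a = M u \<bullet> v - M v \<bullet> u"
  define b where "b = \<bar>M v \<bullet> v\<bar> + 1"
  have b: "b > 0" "M v \<bullet> v \<le> b - 1" by (auto simp: b_def)
  have "s * a \<le> s\<^sup>2 * (M v \<bullet> v)" for s
    using le[of u "u + s *\<^sub>R v"]
    by (simp add: a_def linear_add[OF lin] linear_scale[OF lin] inner_simps algebra_simps power2_eq_square)
  \<comment> \<open>The left side is \<open>b\<close> times the square of \<open>a / b\<close>, and
    \<open>b - 1\<close> bounds \<open>M v \<bullet> v\<close>; hence that square is at most
    0.\<close>
  then have "a / b * a \<le> (a / b)\<^sup>2 * (M v \<bullet> v)" .
  also have "\<dots> \<le> (a / b)\<^sup>2 * (b - 1)" using b by (intro mult_left_mono) auto
  finally have "(a / b)\<^sup>2 \<le> 0" using b by (simp add: field_simps power2_eq_square)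
  then have "a = 0" using b by simp
  then show ?thesis by (simp add: a_def inner_commute)
qed

text \<open>The orthogonal complement of the range of a symmetric map lies in its kernel, so the
  component of \<open>w\<close> orthogonal to the range is a suitable \<open>z\<close>.\<close>

lemma symmetric_kernel_separates:
  fixes M :: "'a::euclidean_space \<Rightarrow> 'a"
  assumes lin: "linear M" and sym: "\<And>u v. M u \<bullet> v = u \<bullet> M v" and w: "w \<notin> range M"
  obtains z where "M z = 0" "w \<bullet> z > 0"
proof -
  have sub: "span (range M) = range M"
    using lin by (simp add: linear_subspace_image)
  obtain a z where az: "a \<in> span (range M)" "\<And>x. x \<in> span (range M) \<Longrightarrow> orthogonal z x" "w = a + z"
    using orthogonal_subspace_decomp_exists by blast
  have "M z \<bullet> M z = z \<bullet> M (M z)" by (rule sym)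
  also have "\<dots> = 0" using az(2)[of "M (M z)"] by (simp add: sub orthogonal_def)
  finally have "M z = 0" by simp
  moreover have "z \<noteq> 0" using az w sub by auto
  moreover have "w \<bullet> z = z \<bullet> z"
    using az(2)[OF az(1)] az(3) by (simp add: orthogonal_def inner_simps inner_commute)
  ultimately show thesis using that by auto
qed

context prox_parameter
begin

text \<open>Optimality of \<open>prox_point y\<close> says that \<open>y\<close> is a subgradient of
  \<open>\<phi>\<close> plus the gradient \<open>c *\<^sub>R prox_point y\<close> of the square;
  this is the former.\<close>

abbreviation prox_slope :: "'a \<Rightarrow> 'a" where
  "prox_slope y \<equiv> y - c *\<^sub>R prox_point y"

lemma quadratic_minorant_at_prox_point:
  "ereal (real_of_ereal (\<phi> (prox_point y)) + (prox_slope y) \<bullet> (z - prox_point y)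
     - c / 2 * (norm (z - prox_point y))\<^sup>2) \<le> \<phi> z"
proof (rule order_trans[OF _ fenchel_young[of y z]])
  show "ereal (real_of_ereal (\<phi> (prox_point y)) + (prox_slope y) \<bullet> (z - prox_point y)
     - c / 2 * (norm (z - prox_point y))\<^sup>2) \<le> ereal (y \<bullet> z - c / 2 * (norm z)\<^sup>2 - conj_fun y)"
    unfolding fenchel_young_eq
    by (simp add: power2_norm_eq_inner inner_simps inner_commute algebra_simps diff_divide_distrib add_divide_distrib)
qed

lemma prox_point_in_gph_subdiff: "(prox_point y, prox_slope y) \<in> gph_subdiff \<phi>"
  using subdiff_if_quadratic_minorant[OF prox_value _ quadratic_minorant_at_prox_point, of y] c_pos
  by (simp add: gph_subdiff_def)

text \<open>Half of the usual second-order quotient, as the divisor is \<open>t^2\<close>; this is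
  the source of the factors 2 below.\<close>

definition conj_quot :: "'a \<Rightarrow> real \<Rightarrow> 'a \<Rightarrow> real" where
  "conj_quot y t u = (conj_fun (y + t *\<^sub>R u) - conj_fun y - t * (prox_point y \<bullet> u)) / t\<^sup>2"

text \<open>The second-order quotient that results when the values of \<open>\<phi>\<close> are
  replaced by their Fenchel bounds, with parameter \<open>y + t *\<^sub>R u\<close> at the moved
  point. It serves both for the lower bound and for the case of equality.\<close>

lemma second_diff_quot_fenchel_identity:
  assumes "t \<noteq> 0"
  shows "(((y + t *\<^sub>R u) \<bullet> (prox_point y + t *\<^sub>R w) - c / 2 * (norm (prox_point y + t *\<^sub>R w))\<^sup>2 - conj_fun (y + t *\<^sub>R u))
      - (y \<bullet> prox_point y - c / 2 * (norm (prox_point y))\<^sup>2 - conj_fun y)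
      - t * ((prox_slope y) \<bullet> w)) / (1 / 2 * t\<^sup>2)
    = 2 * (w \<bullet> u) - 2 * conj_quot y t u - c * (norm w)\<^sup>2"
proof -
  have eq: "((y + t *\<^sub>R u) \<bullet> (prox_point y + t *\<^sub>R w) - c / 2 * (norm (prox_point y + t *\<^sub>R w))\<^sup>2 - conj_fun (y + t *\<^sub>R u))
      - (y \<bullet> prox_point y - c / 2 * (norm (prox_point y))\<^sup>2 - conj_fun y)
      - t * ((prox_slope y) \<bullet> w)
    = (1 / 2 * t\<^sup>2) * (2 * (w \<bullet> u) - c * (norm w)\<^sup>2) - (conj_fun (y + t *\<^sub>R u) - conj_fun y - t * (prox_point y \<bullet> u))"
    unfolding power2_norm_eq_inner
    by (simp add: inner_simps inner_commute algebra_simps power2_eq_square diff_divide_distrib add_divide_distrib)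
  have "((1 / 2 * s) * a - d) / (1 / 2 * s) = a - 2 * (d / s)" if "s \<noteq> 0" for s a d :: real
    using that by (simp add: field_simps)
  note quot = this
  have "t\<^sup>2 \<noteq> 0" using assms by simp
  then show ?thesis
    unfolding eq conj_quot_def by (subst quot) linarith+
qed

lemma second_diff_quot_ge:
  assumes t: "t > 0"
  shows "ereal (2 * (w \<bullet> u) - 2 * conj_quot y t u - c * (norm w)\<^sup>2)
    \<le> second_diff_quot \<phi> (prox_point y) (prox_slope y) t w"
proof (cases "\<phi> (prox_point y + t *\<^sub>R w)")
  case (real a)
  then have "(y + t *\<^sub>R u) \<bullet> (prox_point y + t *\<^sub>R w) - c / 2 * (norm (prox_point y + t *\<^sub>R w))\<^sup>2 - conj_fun (y + t *\<^sub>R u) \<le> a"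
    using fenchel_young[of "y + t *\<^sub>R u" "prox_point y + t *\<^sub>R w"] by simp
  then have "2 * (w \<bullet> u) - 2 * conj_quot y t u - c * (norm w)\<^sup>2
      \<le> (a - (y \<bullet> prox_point y - c / 2 * (norm (prox_point y))\<^sup>2 - conj_fun y)
      - t * ((prox_slope y) \<bullet> w)) / (1 / 2 * t\<^sup>2)"
    unfolding second_diff_quot_fenchel_identity[OF less_imp_neq[OF t, symmetric], of y u w, symmetric] using t
    by (intro divide_right_mono diff_right_mono) auto
  then show ?thesis
    unfolding second_diff_quot_def fenchel_young_eq real using t by simp
next
  case PInf
  then show ?thesis
    unfolding second_diff_quot_def fenchel_young_eq using t by simp
qed (use not_MInf in auto)

text \<open>This direction leads in time \<open>t\<close> from \<open>prox_point y\<close> to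
  \<open>prox_point (y + t *\<^sub>R u)\<close>, where the Fenchel inequality with parameter
  \<open>y + t *\<^sub>R u\<close> is an equality.\<close>

definition prox_quot :: "'a \<Rightarrow> real \<Rightarrow> 'a \<Rightarrow> 'a" where
  "prox_quot y t u = (prox_point (y + t *\<^sub>R u) - prox_point y) /\<^sub>R t"

lemma second_diff_quot_prox_quot:
  assumes t: "t > 0"
  shows "second_diff_quot \<phi> (prox_point y) (prox_slope y) t (prox_quot y t u)
    = ereal (2 * (prox_quot y t u \<bullet> u) - 2 * conj_quot y t u - c * (norm (prox_quot y t u))\<^sup>2)"
proof -
  have w: "prox_point y + t *\<^sub>R prox_quot y t u = prox_point (y + t *\<^sub>R u)"
    using t by (simp add: prox_quot_def)
  show ?thesis
    unfolding second_diff_quot_fenchel_identity[OF less_imp_neq[OF t, symmetric], of y u "prox_quot y t u", symmetric]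
    unfolding second_diff_quot_def w fenchel_young_eq using t by simp
qed

context
  fixes y :: 'a and M :: "'a \<Rightarrow> 'a"
  assumes deriv: "(prox_point has_derivative M) (at y)"
begin

lemma linear_prox_derivative: "linear M"
  using deriv by (rule has_derivative_linear)

lemma conj_quot_tendsto: "((\<lambda>t. conj_quot y t u) \<longlongrightarrow> (M u \<bullet> u) / 2) (at_right 0)"
  unfolding conj_quot_def by (rule conj_fun_second_order[OF deriv])

text \<open>For fixed \<open>u\<close> the Fenchel bound on the quotients converges as
  \<open>t\<close> tends to 0 and the direction to \<open>w\<close>. The free \<open>u\<close>
  yields a whole family of lower bounds.\<close>

lemma second_subderiv_ge: "ereal (2 * (w \<bullet> u) - M u \<bullet> u - c * (norm w)\<^sup>2) \<le> second_subderiv \<phi> (prox_point y) (prox_slope y) w"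
  unfolding second_subderiv_def le_Liminf_iff
proof (intro allI impI)
  fix b assume b: "b < ereal (2 * (w \<bullet> u) - M u \<bullet> u - c * (norm w)\<^sup>2)"
  let ?F = "at_right (0::real) \<times>\<^sub>F nhds w"
  have fst: "filterlim fst (at_right 0) ?F" and snd: "filterlim snd (nhds w) ?F"
    by (rule filterlim_fst filterlim_snd)+
  have "((\<lambda>p. ereal (2 * (snd p \<bullet> u) - 2 * conj_quot y (fst p) u - c * (norm (snd p))\<^sup>2)) \<longlongrightarrow>
      ereal (2 * (w \<bullet> u) - 2 * ((M u \<bullet> u) / 2) - c * (norm w)\<^sup>2)) ?F"
    by (intro tendsto_intros snd filterlim_compose[OF conj_quot_tendsto fst])
  then have ev: "\<forall>\<^sub>F p in ?F. b < ereal (2 * (snd p \<bullet> u) - 2 * conj_quot y (fst p) u - c * (norm (snd p))\<^sup>2)"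
    by (rule order_tendstoD) (use b in simp)
  have "\<forall>\<^sub>F p in ?F. fst p > 0"
    using fst eventually_at_right_less[of 0] unfolding filterlim_iff by blast
  with ev show "\<forall>\<^sub>F p in ?F. b < (case p of (t, w) \<Rightarrow> second_diff_quot \<phi> (prox_point y) (prox_slope y) t w)"
  proof eventually_elim
    case (elim p)
    then show ?case
      using second_diff_quot_ge[of "fst p" "snd p" u y] by (cases p) (auto intro: less_le_trans)
  qed
qed

lemma prox_quot_tendsto: "((\<lambda>t. prox_quot y t u) \<longlongrightarrow> M u) (at_right 0)"
  unfolding prox_quot_def by (rule has_derivative_right_quotient[OF deriv])

lemma second_diff_quot_prox_quot_tendsto:
  "((\<lambda>t. second_diff_quot \<phi> (prox_point y) (prox_slope y) t (prox_quot y t u)) \<longlongrightarrow> ereal (M u \<bullet> u - c * (norm (M u))\<^sup>2)) (at_right 0)"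
proof -
  have "((\<lambda>t. ereal (2 * (prox_quot y t u \<bullet> u) - 2 * conj_quot y t u - c * (norm (prox_quot y t u))\<^sup>2)) \<longlongrightarrow>
      ereal (2 * (M u \<bullet> u) - 2 * ((M u \<bullet> u) / 2) - c * (norm (M u))\<^sup>2)) (at_right 0)"
    by (intro tendsto_intros prox_quot_tendsto conj_quot_tendsto)
  moreover have "\<forall>\<^sub>F t in at_right 0. ereal (2 * (prox_quot y t u \<bullet> u) - 2 * conj_quot y t u - c * (norm (prox_quot y t u))\<^sup>2)
      = second_diff_quot \<phi> (prox_point y) (prox_slope y) t (prox_quot y t u)"
    using eventually_at_right_less[of 0]
    by eventually_elim (simp add: second_diff_quot_prox_quot)
  ultimately show ?thesis using Lim_transform_eventually by fastforce
qed

text \<open>The path of \<open>prox_quot\<close> gives the upper bound, and the Fenchel bound with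
  the same \<open>u\<close> matches it.\<close>

lemma second_subderiv_range: "second_subderiv \<phi> (prox_point y) (prox_slope y) (M u) = ereal (M u \<bullet> u - c * (norm (M u))\<^sup>2)"
proof (rule antisym)
  have "filterlim (\<lambda>t. (t, prox_quot y t u)) (at_right 0 \<times>\<^sub>F nhds (M u)) (at_right 0)"
    by (intro filterlim_Pair filterlim_ident prox_quot_tendsto)
  then show "second_subderiv \<phi> (prox_point y) (prox_slope y) (M u) \<le> ereal (M u \<bullet> u - c * (norm (M u))\<^sup>2)"
    unfolding second_subderiv_def
    by (rule Liminf_le_lim_compose) (use second_diff_quot_prox_quot_tendsto in simp_all)
  show "ereal (M u \<bullet> u - c * (norm (M u))\<^sup>2) \<le> second_subderiv \<phi> (prox_point y) (prox_slope y) (M u)"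
    using second_subderiv_ge[of "M u" u] by simp
qed

text \<open>
  The derivative of a gradient is symmetric; here this follows without a theorem on second
  derivatives, by comparing the exact value at \<open>M u\<close> with the Fenchel bounds.
\<close>

lemma prox_derivative_symmetric: "M u \<bullet> u' = u \<bullet> M u'"
proof (rule quadratic_polarization_symmetric[OF linear_prox_derivative])
  show "2 * (M u \<bullet> u') - M u' \<bullet> u' \<le> M u \<bullet> u" for u u'
    using second_subderiv_ge[of "M u" u'] by (simp add: second_subderiv_range)
qed

text \<open>Along multiples of a kernel vector \<open>z\<close> with
  \<open>w \<bullet> z > 0\<close> the Fenchel lower bound is affine with positive slope, hence
  unbounded; \<open>s\<close> is chosen to reach the value \<open>B\<close>.\<close>

lemma second_subderiv_off_range:
  assumes "w \<notin> range M"
  shows "second_subderiv \<phi> (prox_point y) (prox_slope y) w = \<infinity>"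
proof -
  obtain z where z: "M z = 0" "w \<bullet> z > 0"
    using symmetric_kernel_separates[OF linear_prox_derivative prox_derivative_symmetric assms] by blast
  have "ereal B \<le> second_subderiv \<phi> (prox_point y) (prox_slope y) w" for B
  proof -
    define s where "s = (B + c * (norm w)\<^sup>2) / (2 * (w \<bullet> z))"
    have "2 * s * (w \<bullet> z) = B + c * (norm w)\<^sup>2" using z by (simp add: s_def)
    then have "B = 2 * (w \<bullet> (s *\<^sub>R z)) - M (s *\<^sub>R z) \<bullet> (s *\<^sub>R z) - c * (norm w)\<^sup>2"
      using z by (simp add: linear_scale[OF linear_prox_derivative])
    then show ?thesis using second_subderiv_ge[of w "s *\<^sub>R z"] by simp
  qed
  then show ?thesis by (metis ereal_top)
qed

text \<open>On the range of \<open>M\<close> the proximal quotients are recovery sequences. Off it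
  the lower limit is \<infinity>, so the constant sequence works.\<close>

lemma twice_epi_differentiable_at_prox_point: "twice_epi_differentiable \<phi> (prox_point y) (prox_slope y)"
  unfolding twice_epi_differentiable_def
proof (intro allI impI, elim conjE)
  fix w and t :: "nat \<Rightarrow> real" assume t: "\<forall>k. t k > 0" "t \<longlonglongrightarrow> 0"
  then have tlim: "filterlim t (at_right 0) sequentially"
    by (intro tendsto_imp_filterlim_at_right) auto
  show "\<exists>ws. ws \<longlonglongrightarrow> w \<and> (\<lambda>k. second_diff_quot \<phi> (prox_point y) (prox_slope y) (t k) (ws k)) \<longlonglongrightarrow> second_subderiv \<phi> (prox_point y) (prox_slope y) w"
  proof (cases "w \<in> range M")
    case True
    then obtain u where w: "w = M u" by auto
    show ?thesis
      unfolding w second_subderiv_range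
      using filterlim_compose[OF prox_quot_tendsto tlim] filterlim_compose[OF second_diff_quot_prox_quot_tendsto tlim]
      by blast
  next
    case False
    have lim: "filterlim (\<lambda>k. (t k, w)) (at_right 0 \<times>\<^sub>F nhds w) sequentially"
      by (intro filterlim_Pair tlim tendsto_const)
    have "\<forall>\<^sub>F k in sequentially. b < second_diff_quot \<phi> (prox_point y) (prox_slope y) (t k) w"
      if "b < \<infinity>" for b
    proof -
      have "\<forall>\<^sub>F p in at_right 0 \<times>\<^sub>F nhds w.
          b < (case p of (t, u) \<Rightarrow> second_diff_quot \<phi> (prox_point y) (prox_slope y) t u)"
        using second_subderiv_off_range[OF False] that
        by (intro less_LiminfD) (simp add: second_subderiv_def)
      from eventually_compose_filterlim[OF this lim] show ?thesis by simp
    qed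
    then have "(\<lambda>k. second_diff_quot \<phi> (prox_point y) (prox_slope y) (t k) w) \<longlonglongrightarrow> \<infinity>"
      by (simp add: tendsto_PInfty)
    then show ?thesis
      unfolding second_subderiv_off_range[OF False] by (intro exI[of _ "\<lambda>_. w"]) auto
  qed
qed

end

end

text \<open>A generalized inverse \<open>T\<close> of \<open>M\<close> picks a preimage of each
  \<open>w\<close> in the range, which turns the second subderivative there into
  \<open>w \<bullet> T w - c * (norm w)^2\<close>.\<close>

lemma generalized_twice_differentiable_at_prox_point:
  fixes \<phi> :: "real ^ 'n \<Rightarrow> ereal"
  assumes prox: "prox_parameter \<phi> \<rho> c"
    and deriv: "(prox_parameter.prox_point \<phi> \<rho> c has_derivative M) (at y)"
  shows "generalized_twice_differentiable \<phi> (prox_parameter.prox_point \<phi> \<rho> c y)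
    (y - c *\<^sub>R prox_parameter.prox_point \<phi> \<rho> c y)"
proof -
  interpret prox_parameter \<phi> \<rho> c by (rule prox)
  have lin: "linear M" by (rule linear_prox_derivative[OF deriv])
  have sym: "M u \<bullet> u' = u \<bullet> M u'" for u u' by (rule prox_derivative_symmetric[OF deriv])
  obtain T where T: "linear T" "\<And>u. M (T (M u)) = M u"
    using linear_exists_right_inverse_on[OF lin subspace_UNIV] by auto
  \<comment> \<open>Averaging \<open>T\<close> with its adjoint makes the map symmetric and leaves
    the values \<open>w \<bullet> T w\<close> unchanged.\<close>
  define B where "B = (\<lambda>w. (1 / 2) *\<^sub>R (T w + adjoint T w) - c *\<^sub>R w)"
  have linB: "linear B"
    unfolding B_def by (intro linear_compose_sub linear_compose_scale_right linear_compose_add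
        T(1) adjoint_linear[OF T(1)] linear_id[unfolded id_def])
  have "adjoint B = B"
    by (rule adjoint_unique)
      (simp add: B_def inner_simps adjoint_clauses[OF T(1)])
  then have "transpose (matrix B) = matrix B"
    using matrix_adjoint[OF linB] by simp
  moreover have "subspace (range M)"
    using lin by (simp add: linear_subspace_image)
  moreover have "second_subderiv \<phi> (prox_point y) (prox_slope y) w
      = ereal (w \<bullet> (matrix B *v w)) + set_delta (range M) w" for w
  proof (cases "w \<in> range M")
    case True
    then have MT: "M (T w) = w" using T(2) by auto
    have "matrix B *v w = B w" using matrix_vector_mul(2)[OF linB] by (rule fun_cong)
    then have "w \<bullet> (matrix B *v w) = w \<bullet> T w - c * (norm w)\<^sup>2"
      by (simp add: B_def inner_simps adjoint_works[OF T(1)] power2_norm_eq_inner inner_commute)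
    then show ?thesis
      using second_subderiv_range[OF deriv, of "T w"] True by (simp add: MT set_delta_def)
  next
    case False
    then show ?thesis
      using second_subderiv_off_range[OF deriv False] by (simp add: set_delta_def)
  qed
  ultimately show ?thesis
    using twice_epi_differentiable_at_prox_point[OF deriv]
    unfolding generalized_twice_differentiable_def generalized_quadratic_form_def by blast
qed

section \<open>Convexity\<close>

context prox_parameter
begin

text \<open>The gradient bound is integrated along the segment: \<open>\<psi>\<close> is
  \<open>conj_fun\<close> minus the growth allowed by the claim, and its derivative is
  nonpositive.\<close>

lemma conj_fun_descent:
  assumes incr: "\<And>z w. (prox_point (z + w) - prox_point z) \<bullet> w \<le> (norm w)\<^sup>2 / c"
  shows "conj_fun (y + u) \<le> conj_fun y + prox_point y \<bullet> u + (norm u)\<^sup>2 / (2 * c)"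
proof -
  define \<psi> where "\<psi> = (\<lambda>s. conj_fun (y + s *\<^sub>R u) - s * (prox_point y \<bullet> u) - s\<^sup>2 * ((norm u)\<^sup>2 / (2 * c)))"
  have "\<psi> 1 \<le> \<psi> 0"
  proof (rule DERIV_nonpos_imp_nonincreasing[where f = \<psi>])
    fix s :: real assume s: "0 \<le> s" "s \<le> 1"
    let ?d = "(prox_point (y + s *\<^sub>R u) - prox_point y) \<bullet> u - s * ((norm u)\<^sup>2 / c)"
    have "((\<lambda>s. y + s *\<^sub>R u) has_derivative (\<lambda>h. h *\<^sub>R u)) (at s)"
      by (auto intro!: derivative_eq_intros)
    from has_derivative_compose[OF this conj_fun_has_derivative]
    have "((\<lambda>s. conj_fun (y + s *\<^sub>R u)) has_real_derivative prox_point (y + s *\<^sub>R u) \<bullet> u) (at s)"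
      by (simp add: has_field_derivative_def mult_commute_abs)
    then have "(\<psi> has_real_derivative ?d) (at s)"
      unfolding \<psi>_def using c_pos by (auto intro!: derivative_eq_intros simp: inner_diff_left)
    moreover have "?d \<le> 0"
    proof (cases "s = 0")
      case False
      have "s * ((prox_point (y + s *\<^sub>R u) - prox_point y) \<bullet> u) \<le> s * (s * ((norm u)\<^sup>2 / c))"
        using incr[of y "s *\<^sub>R u"] s by (simp add: power2_eq_square mult_ac)
      then have "(prox_point (y + s *\<^sub>R u) - prox_point y) \<bullet> u \<le> s * ((norm u)\<^sup>2 / c)"
        by (rule mult_left_le_imp_le) (use s False in simp)
      then show ?thesis by simp
    qed simp
    ultimately show "\<exists>y. DERIV \<psi> s :> y \<and> y \<le> 0" by blast
  qed simp
  then show ?thesis by (simp add: \<psi>_def)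
qed

text \<open>The Fenchel inequality with parameter \<open>y + c *\<^sub>R d\<close>, which is the
  best choice once \<open>conj_fun\<close> is replaced by its quadratic upper bound. The quadratic
  terms then cancel.\<close>

lemma affine_minorant_at_prox_point:
  assumes incr: "\<And>z w. (prox_point (z + w) - prox_point z) \<bullet> w \<le> (norm w)\<^sup>2 / c"
  shows "\<phi> (prox_point y) + ereal (prox_slope y \<bullet> (x - prox_point y)) \<le> \<phi> x"
proof -
  define d where "d = x - prox_point y"
  have x: "x = prox_point y + d" by (simp add: d_def)
  have "conj_fun (y + c *\<^sub>R d) \<le> conj_fun y + c * (prox_point y \<bullet> d) + c / 2 * (norm d)\<^sup>2"
    using conj_fun_descent[OF incr, of y "c *\<^sub>R d"] c_pos by (simp add: power_mult_distrib power2_eq_square mult_ac)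
  then have "y \<bullet> prox_point y - c / 2 * (norm (prox_point y))\<^sup>2 - conj_fun y + prox_slope y \<bullet> d
      \<le> (y + c *\<^sub>R d) \<bullet> x - c / 2 * (norm x)\<^sup>2 - conj_fun (y + c *\<^sub>R d)"
    unfolding x power2_norm_eq_inner by (simp add: inner_simps inner_commute algebra_simps)
  then have "\<phi> (prox_point y) + ereal (prox_slope y \<bullet> d)
      \<le> ereal ((y + c *\<^sub>R d) \<bullet> x - c / 2 * (norm x)\<^sup>2 - conj_fun (y + c *\<^sub>R d))"
    unfolding fenchel_young_eq by simp
  also have "\<dots> \<le> \<phi> x" by (rule fenchel_young)
  finally show ?thesis by (simp add: d_def)
qed

text \<open>Nonnegativity at \<open>M w\<close> reads
  \<open>c * (norm (M w))^2 \<le> M w \<bullet> w\<close>, and Cauchy-Schwarz turns this into a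
  bound on \<open>M w \<bullet> w\<close>. By \<open>rademacher\<close> it holds almost everywhere,
  and \<open>lipschitz_increment_le\<close> integrates it.\<close>

lemma prox_increment_le_if_second_subderiv_nonneg:
  assumes nonneg: "\<And>y M w. (prox_point has_derivative M) (at y) \<Longrightarrow>
      0 \<le> second_subderiv \<phi> (prox_point y) (prox_slope y) w"
  shows "(prox_point (z + w) - prox_point z) \<bullet> w \<le> (norm w)\<^sup>2 / c"
proof -
  let ?f = "\<lambda>z. prox_point z \<bullet> w"
  have lip: "(1 / (c - \<rho>) * norm w)-lipschitz_on UNIV ?f"
  proof (rule lipschitz_onI)
    fix y z
    have "dist (?f y) (?f z) \<le> norm (prox_point y - prox_point z) * norm w"
      using Cauchy_Schwarz_ineq2[of "prox_point y - prox_point z" w]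
      by (simp add: dist_real_def inner_diff_left)
    also have "\<dots> \<le> (1 / (c - \<rho>) * dist y z) * norm w"
      using lipschitz_onD[OF prox_point_lipschitz, of y z]
      by (intro mult_right_mono) (auto simp: dist_norm)
    finally show "dist (?f y) (?f z) \<le> 1 / (c - \<rho>) * norm w * dist y z" by (simp add: mult_ac)
  qed (use rho_less in simp)
  have "AE y in lborel. \<forall>l. has_dirderiv ?f w l y \<longrightarrow> l \<le> (norm w)\<^sup>2 / c"
    using rademacher[OF prox_point_lipschitz]
  proof eventually_elim
    case (elim y)
    then obtain M where M: "(prox_point has_derivative M) (at y)" by (auto simp: differentiable_def)
    have "((\<lambda>t. ((prox_point (y + t *\<^sub>R w) - prox_point y) /\<^sub>R t) \<bullet> w) \<longlongrightarrow> M w \<bullet> w) (at_right 0)"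
      by (intro tendsto_inner tendsto_const has_derivative_right_quotient[OF M])
    then have dir: "has_dirderiv ?f w (M w \<bullet> w) y"
      unfolding has_dirderiv_def by (simp add: inner_diff_left divide_inverse mult.commute)
    have le: "c * (norm (M w))\<^sup>2 \<le> M w \<bullet> w"
      using nonneg[OF M, of "M w"] by (simp add: second_subderiv_range[OF M])
    have cs: "M w \<bullet> w \<le> norm (M w) * norm w" by (rule norm_cauchy_schwarz)
    have "c * norm (M w) \<le> norm w"
    proof (cases "M w = 0")
      case False
      have "c * norm (M w) * norm (M w) \<le> norm w * norm (M w)"
        using le cs by (simp add: power2_eq_square mult_ac)
      then show ?thesis using False by (simp add: mult_le_cancel_right)
    qed simp
    then have "norm (M w) * norm w \<le> norm w / c * norm w"
      using c_pos by (intro mult_right_mono) (auto simp: field_simps)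
    with cs have "M w \<bullet> w \<le> (norm w)\<^sup>2 / c" by (simp add: power2_eq_square)
    then show ?case using has_dirderiv_unique[OF dir] by auto
  qed
  from lipschitz_increment_le[OF lip this, of z] show ?thesis by (simp add: inner_diff_left)
qed

end

context weakly_convex_function
begin

lemma convex_if_prox_increment_le:
  assumes incr: "\<And>c z w. \<rho> < c \<Longrightarrow>
    (prox_parameter.prox_point \<phi> \<rho> c (z + w) - prox_parameter.prox_point \<phi> \<rho> c z) \<bullet> w \<le> (norm w)\<^sup>2 / c"
  shows "convex_fun \<phi>"
  unfolding convex_fun_def s_convex_def
proof (intro allI impI)
  fix x y :: 'a and l :: real assume l: "0 < l \<and> l < 1"
  let ?z = "(1 - l) *\<^sub>R x + l *\<^sub>R y"
  let ?R = "ereal (1 - l) * \<phi> x + ereal l * \<phi> y - ereal (0 / 2 * l * (1 - l) * (norm (x - y))\<^sup>2)"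
  show "\<phi> ?z \<le> ?R"
  proof (cases "\<phi> x = \<infinity> \<or> \<phi> y = \<infinity>")
    case True
    then have "?R = \<infinity>"
      using l not_MInf[of x] not_MInf[of y] by (cases "\<phi> x"; cases "\<phi> y") auto
    then show ?thesis by (simp only: ereal_less_eq(1))
  next
    case False
    then obtain a b where ab: "\<phi> x = ereal a" "\<phi> y = ereal b"
      using not_MInf[of x] not_MInf[of y] by (cases "\<phi> x"; cases "\<phi> y") auto
    define R where "R = (1 - l) * a + l * b"
    \<comment> \<open>The affine minorant at \<open>p\<close> has slope
      \<open>c *\<^sub>R (?z - p)\<close>. Averaging its values at \<open>x\<close> and
      \<open>y\<close> evaluates it at \<open>?z\<close>, where the linear term is a squared
      distance.\<close>
    have upper: "\<exists>r. \<phi> p = ereal r \<and> r + c * (norm (?z - p))\<^sup>2 \<le> R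
        \<and> (\<forall>w s. \<phi> w = ereal s \<longrightarrow> r + (c *\<^sub>R ?z - c *\<^sub>R p) \<bullet> (w - p) \<le> s)"
      if c: "\<rho> < c" and p: "p = prox_parameter.prox_point \<phi> \<rho> c (c *\<^sub>R ?z)" for c p
    proof -
      interpret prox_parameter \<phi> \<rho> c by unfold_locales (rule c)
      obtain r where r: "\<phi> p = ereal r" using prox_value p by metis
      have minor: "r + (c *\<^sub>R ?z - c *\<^sub>R p) \<bullet> (w - p) \<le> s" if "\<phi> w = ereal s" for w s
        using affine_minorant_at_prox_point[OF incr[OF c], of "c *\<^sub>R ?z" w] that r p by simp
      have "(1 - l) * (r + (c *\<^sub>R ?z - c *\<^sub>R p) \<bullet> (x - p)) + l * (r + (c *\<^sub>R ?z - c *\<^sub>R p) \<bullet> (y - p)) \<le> R"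
        unfolding R_def using l by (intro add_mono mult_left_mono minor ab) auto
      moreover have "(1 - l) * (r + (c *\<^sub>R ?z - c *\<^sub>R p) \<bullet> (x - p)) + l * (r + (c *\<^sub>R ?z - c *\<^sub>R p) \<bullet> (y - p))
          = r + (c *\<^sub>R ?z - c *\<^sub>R p) \<bullet> (?z - p)"
        by (simp add: inner_add_right inner_diff_right algebra_simps)
      moreover have "(c *\<^sub>R ?z - c *\<^sub>R p) \<bullet> (?z - p) = c * (norm (?z - p))\<^sup>2"
        by (simp add: power2_norm_eq_inner flip: scaleR_diff_right)
      ultimately show ?thesis using r minor by auto
    qed
    \<comment> \<open>One affine minorant, fixed before \<open>c\<close> varies, bounds
      \<open>\<phi>\<close> at all proximal points from below.\<close>
    obtain q r0 v where q: "\<And>w s. \<phi> w = ereal s \<Longrightarrow> r0 + v \<bullet> (w - q) \<le> s"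
      using upper[of "\<rho> + 1"] by auto
    define C where "C = \<bar>R - r0 - v \<bullet> (?z - q)\<bar>"
    \<comment> \<open>A violation would persist on a ball around \<open>?z\<close> by lower
      semicontinuity, while for large \<open>c\<close> the proximal point enters this ball with
      value at most \<open>R\<close>.\<close>
    show ?thesis
    proof (rule ccontr)
      assume "\<not> \<phi> ?z \<le> ?R"
      then have "ereal R < \<phi> ?z" using ab by (simp add: R_def not_le)
      then have "\<forall>\<^sub>F z in nhds ?z. ereal R < \<phi> z"
        using lsc unfolding lower_semicontinuous_iff by blast
      then obtain \<delta> where \<delta>: "\<delta> > 0" "\<And>z. dist z ?z < \<delta> \<Longrightarrow> ereal R < \<phi> z"
        unfolding eventually_nhds_metric by blast
      define K where "K = C + norm v"
      have K: "K \<ge> 0" by (simp add: K_def C_def)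
      \<comment> \<open>\<open>c d\<^sup>2 \<le> C + |v| d\<close> holds for the distance \<open>d\<close> to the proximal point; this \<open>c\<close> forces \<open>d < 1\<close> and \<open>d < \<delta>\<close>.\<close>
      define c where "c = \<rho> + 1 + K + K / \<delta>\<^sup>2"
      have c: "\<rho> < c" "c > K" "c > K / \<delta>\<^sup>2" "c > 0"
        using K \<delta>(1) rho_nonneg by (auto simp: c_def add_nonneg_pos add_pos_nonneg)
      define p where "p = prox_parameter.prox_point \<phi> \<rho> c (c *\<^sub>R ?z)"
      obtain r where r: "\<phi> p = ereal r" "r + c * (norm (?z - p))\<^sup>2 \<le> R"
        using upper[OF c(1) p_def] by blast
      define d where "d = norm (?z - p)"
      have "v \<bullet> (p - q) = v \<bullet> (?z - q) - v \<bullet> (?z - p)" by (simp add: inner_diff_right)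
      moreover have "v \<bullet> (?z - p) \<le> norm v * d" unfolding d_def by (rule norm_cauchy_schwarz)
      ultimately have cd: "c * d\<^sup>2 \<le> C + norm v * d"
        using q[OF r(1)] r(2) by (simp add: C_def d_def)
      have d1: "d < 1"
      proof (rule ccontr)
        assume "\<not> d < 1"
        then have d: "1 \<le> d" "d \<le> d\<^sup>2" "1 \<le> d\<^sup>2"
          using self_le_power[of d 2] one_le_power[of d 2] by auto
        have "C + norm v * d \<le> C * d\<^sup>2 + norm v * d\<^sup>2"
          using d by (intro add_mono mult_left_mono) (auto simp: C_def mult_le_cancel_left1)
        also have "\<dots> = K * d\<^sup>2" by (simp add: K_def algebra_simps)
        also have "\<dots> < c * d\<^sup>2" using c d by (intro mult_strict_right_mono) auto
        finally show False using cd by simp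
      qed
      have "c * d\<^sup>2 \<le> K"
        using cd d1 mult_left_mono[of d 1 "norm v"] by (simp add: K_def)
      also have "K < c * \<delta>\<^sup>2" using c(3) \<delta>(1) by (simp add: field_simps)
      finally have "d\<^sup>2 < \<delta>\<^sup>2" using c(4) by simp
      then have "d < \<delta>" using \<delta>(1) by (simp add: power_less_imp_less_base)
      then have "ereal R < \<phi> p" using \<delta>(2)[of p] by (simp add: d_def dist_norm norm_minus_commute)
      moreover have "c * (norm (?z - p))\<^sup>2 \<ge> 0" using c(4) by simp
      ultimately show False using r by simp
    qed
  qed
qed

end

section \<open>Nonnegative second subderivatives of convex functions\<close>

text \<open>Along the segment from \<open>u\<close> to \<open>w\<close> the quotient for a regular
  normal is constant, so an upper limit of at most 0 decides its sign. The inequality passes to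
  limits of base points and normals.\<close>

lemma convex_limiting_normal:
  fixes \<Omega> :: "'a::real_inner set"
  assumes "convex \<Omega>" and n: "n \<in> limiting_normal_cone \<Omega> z" and w: "w \<in> \<Omega>"
  shows "n \<bullet> (w - z) \<le> 0"
proof -
  have reg: "m \<bullet> (w - u) \<le> 0" if m: "m \<in> regular_normal_cone \<Omega> u" and u: "u \<in> \<Omega>" for m u
  proof (rule ccontr)
    assume pos: "\<not> m \<bullet> (w - u) \<le> 0"
    then have ne: "w \<noteq> u" by auto
    define e where "e = m \<bullet> (w - u) / norm (w - u)"
    have e: "e > 0" using pos ne by (simp add: e_def)
    have "Limsup (at u within \<Omega>) (\<lambda>z. ereal (m \<bullet> (z - u) / norm (z - u))) < ereal e"
      using m e by (auto simp: regular_normal_cone_def intro: le_less_trans)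
    then have "\<forall>\<^sub>F z in at u within \<Omega>. ereal (m \<bullet> (z - u) / norm (z - u)) < ereal e"
      by (rule Limsup_lessD)
    then obtain d where d: "d > 0" "\<And>z. z \<in> \<Omega> \<Longrightarrow> z \<noteq> u \<Longrightarrow> dist z u < d \<Longrightarrow> m \<bullet> (z - u) / norm (z - u) < e"
      unfolding eventually_at by auto
    define t where "t = min 1 (d / (2 * norm (w - u)))"
    have t: "0 < t" "t \<le> 1" "t * norm (w - u) < d"
      using d(1) ne by (auto simp: t_def min_def field_simps)
    define z where "z = (1 - t) *\<^sub>R u + t *\<^sub>R w"
    have zu: "z - u = t *\<^sub>R (w - u)" by (simp add: z_def algebra_simps)
    have "z \<in> \<Omega>" unfolding z_def using t u w by (intro convexD[OF assms(1)]) auto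
    moreover have "z \<noteq> u" using zu t ne by auto
    moreover have "dist z u < d" using t by (simp add: dist_norm zu)
    ultimately have "m \<bullet> (z - u) / norm (z - u) < e" by (rule d(2))
    then show False using t by (simp add: zu e_def)
  qed
  obtain zs ns where s: "zs \<longlonglongrightarrow> z" "\<And>k::nat. zs k \<in> \<Omega>" "ns \<longlonglongrightarrow> n"
    "\<And>k. ns k \<in> regular_normal_cone \<Omega> (zs k)"
    using n unfolding limiting_normal_cone_def by blast
  have "(\<lambda>k. ns k \<bullet> (w - zs k)) \<longlonglongrightarrow> n \<bullet> (w - z)" by (intro tendsto_intros s)
  then show ?thesis by (rule tendsto_upperbound) (use reg s in auto)
qed

lemma convex_epi:
  assumes conv: "convex_fun \<phi>"
  shows "convex (epi \<phi>)"
proof (rule convexI)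
  fix p q :: "'a \<times> real" and u v :: real
  assume pq: "p \<in> epi \<phi>" "q \<in> epi \<phi>" and uv: "0 \<le> u" "0 \<le> v" "u + v = 1"
  show "u *\<^sub>R p + v *\<^sub>R q \<in> epi \<phi>"
  \<comment> \<open>\<open>s_convex\<close> speaks of weights strictly between 0 and 1 only.\<close>
  proof (cases "u = 0 \<or> v = 0")
    case True
    then show ?thesis using pq uv by auto
  next
    case False
    obtain x a y b where p: "p = (x, a)" and q: "q = (y, b)" by (cases p, cases q)
    have u: "u = 1 - v" "0 < v" "v < 1" using False uv by auto
    have "\<phi> (u *\<^sub>R x + v *\<^sub>R y) \<le> ereal u * \<phi> x + ereal v * \<phi> y"
      using conv u unfolding convex_fun_def s_convex_def by (auto simp: zero_ereal_def[symmetric])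
    also have "\<dots> \<le> ereal u * ereal a + ereal v * ereal b"
      using pq p q u by (intro add_mono ereal_mult_left_mono) (auto simp: epi_def)
    finally show ?thesis by (simp add: p q epi_def)
  qed
qed

text \<open>The normal \<open>(v, -1)\<close> supports the convex epigraph, so \<open>v\<close> is a
  subgradient in the global sense and every second-order quotient is nonnegative.\<close>

lemma second_subderiv_nonneg_if_convex:
  assumes nm: "\<And>x. \<phi> x \<noteq> -\<infinity>" and conv: "convex_fun \<phi>" and gph: "(x, v) \<in> gph_subdiff \<phi>"
  shows "0 \<le> second_subderiv \<phi> x v w"
proof -
  obtain r where r: "\<phi> x = ereal r"
    using gph nm[of x] by (cases "\<phi> x") (auto simp: gph_subdiff_def subdiff_def edom_def)
  have n: "(v, -1) \<in> limiting_normal_cone (epi \<phi>) (x, r)"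
    using gph r by (simp add: gph_subdiff_def subdiff_def)
  have "0 \<le> second_diff_quot \<phi> x v t u" if t: "t > 0" for t u
  proof (cases "\<phi> (x + t *\<^sub>R u)")
    case (real a)
    then have "(x + t *\<^sub>R u, a) \<in> epi \<phi>" by (simp add: epi_def)
    from convex_limiting_normal[OF convex_epi[OF conv] n this]
    have "0 \<le> a - r - t * (v \<bullet> u)" by simp
    then show ?thesis using t by (simp add: second_diff_quot_def real r)
  qed (use t nm in \<open>auto simp: second_diff_quot_def r\<close>)
  then have "\<forall>\<^sub>F p in at_right 0 \<times>\<^sub>F nhds w. 0 \<le> (case p of (t, u) \<Rightarrow> second_diff_quot \<phi> x v t u)"
  proof -
    have "\<forall>\<^sub>F p in at_right (0::real) \<times>\<^sub>F nhds w. fst p > 0"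
      using eventually_compose_filterlim[OF eventually_at_right_less[of 0] filterlim_fst] .
    then show ?thesis
      by eventually_elim (use \<open>\<And>u t. 0 < t \<Longrightarrow> 0 \<le> second_diff_quot \<phi> x v t u\<close> in auto)
  qed
  then show ?thesis unfolding second_subderiv_def by (rule Liminf_bounded)
qed

theorem theorem3p4:
  fixes \<phi> :: "real ^ 'n \<Rightarrow> ereal"
  assumes "\<forall>x. \<phi> x \<noteq> -\<infinity>"
    and "proper \<phi>"
    and "lower_semicontinuous \<phi>"
    and "weakly_convex \<phi>"
  shows
    "(convex_fun \<phi> \<longleftrightarrow>
        (\<forall>w. \<forall>(x, v)\<in>gph_subdiff \<phi>. second_subderiv \<phi> x v w \<ge> 0)) \<and>
     (convex_fun \<phi> \<longleftrightarrow>
        (\<forall>w. \<forall>(x, v)\<in>gph_subdiff \<phi>. twice_epi_differentiable \<phi> x v \<longrightarrow>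
           second_subderiv \<phi> x v w \<ge> 0)) \<and>
     (convex_fun \<phi> \<longleftrightarrow>
        (\<forall>w. \<forall>(x, v)\<in>gph_subdiff \<phi>. generalized_twice_differentiable \<phi> x v \<longrightarrow>
           second_subderiv \<phi> x v w \<ge> 0))"
    (is "(?i \<longleftrightarrow> ?ii) \<and> (?i \<longleftrightarrow> ?iii) \<and> (?i \<longleftrightarrow> ?iv)")
proof -
  have "?i \<Longrightarrow> ?ii" using second_subderiv_nonneg_if_convex assms(1) by blast
  moreover have "?ii \<Longrightarrow> ?iii" by blast
  moreover have "?iii \<Longrightarrow> ?iv" unfolding generalized_twice_differentiable_def by blast
  \<comment> \<open>Condition \<open>?iv\<close> is applied only at the pairs
    \<open>(prox_point y, prox_slope y)\<close> where \<open>prox_point\<close> is differentiable at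
    \<open>y\<close>, for every parameter \<open>c\<close> above \<open>- s\<close>.\<close>
  moreover have "?i" if iv: ?iv
  proof -
    obtain s where s: "s < 0" "s_convex s \<phi>" using assms(4) by (auto simp: weakly_convex_def)
    interpret weakly_convex_function \<phi> "- s"
      using assms(1-3) s by unfold_locales auto
    show ?i
    proof (rule convex_if_prox_increment_le)
      fix c :: real and z w :: "real ^ 'n" assume "- s < c"
      then interpret prox_parameter \<phi> "- s" c by unfold_locales
      show "(prox_point (z + w) - prox_point z) \<bullet> w \<le> (norm w)\<^sup>2 / c"
      proof (rule prox_increment_le_if_second_subderiv_nonneg)
        fix y M w assume "(prox_point has_derivative M) (at y)"
        then have "generalized_twice_differentiable \<phi> (prox_point y) (prox_slope y)"
          using generalized_twice_differentiable_at_prox_point prox_parameter_axioms by blast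
        with iv prox_point_in_gph_subdiff show "0 \<le> second_subderiv \<phi> (prox_point y) (prox_slope y) w"
          by blast
      qed
    qed
  qed
  ultimately show ?thesis by blast
qed

end
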